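(* Let $d$ be a positive integer, let $N$ be a $2\times 2$ (real symmetric) positive definite matrix with positive entries and let $\underline{\mu}\in\mathbb{R}^2_{>0}$. For any Benjamini--Schramm convergent sequence of $d$-regular graphs $(G_n)_n$ the sequence $$\frac{1}{v(G_n)}\ln Z_{G_n}(N,\underline{\mu})$$ is convergent.
   Context: Graphs are finite; $v(G)$ is the number of vertices of $G$. For a graph $G=(V,E)$, a symmetric $2\times 2$ matrix $N$ and $\underline{\mu}\in\mathbb{R}^2$, $$Z_G(N,\underline{\mu})=\sum_{\sigma:V\to\{1,2\}}\prod_{v\in V}\mu_{\sigma(v)}\prod_{(u,v)\in E}N_{\sigma(u),\sigma(v)}.$$ For a finite graph $G$, a finite connected rooted graph $\alpha$ and a positive integer $r$, let $\mathbb{P}(G,\alpha,r)$ be the probability that the $r$-ball centered at a uniformly random vertex of $G$ is isomorphic (as a rooted graph) to $\alpha$. A bounded-degree graph sequence $(G_n)_n$ is Benjamini--Schramm convergent if for all finite connected rooted graphs $\alpha$ and all $r>0$ the probabilities $\mathbb{P}(G_n,\alpha,r)$ converge. *)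

theory Defs
  imports "HOL-Probability.Probability" "Graph_Theory.Graph_Theory"
begin

text \<open>
  A finite simple graph is a \<^locale>\<open>pair_graph\<close>: a finite vertex set with a symmetric,
  irreflexive adjacency relation \<^const>\<open>parcs\<close>, which contains each undirected edge
  in both orientations.
\<close>

definition edges :: "'a pair_pre_digraph \<Rightarrow> 'a set set" where
  "edges G = (\<lambda>(u, v). {u, v}) ` parcs G"

definition regular_graph :: "nat \<Rightarrow> 'a pair_pre_digraph \<Rightarrow> bool" where
  "regular_graph d G \<longleftrightarrow> pair_graph G \<and> (\<forall>v\<in>pverts G. out_degree (with_proj G) v = d)"


section \<open>Benjamini--Schramm convergence\<close>

definition ball_verts :: "'a pair_pre_digraph \<Rightarrow> 'a \<Rightarrow> nat \<Rightarrow> 'a set" where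
  "ball_verts G v r = {u. \<exists>p. pre_digraph.awalk (with_proj G) v p u \<and> length p \<le> r}"

definition rooted_iso :: "('a, 'b) pre_digraph \<Rightarrow> 'a \<Rightarrow> ('c, 'd) pre_digraph \<Rightarrow> 'c \<Rightarrow> bool" where
  "rooted_iso G u H v \<longleftrightarrow>
    (\<exists>f. pre_digraph.digraph_isomorphism G f \<and> H = app_iso f G \<and> v = iso_verts f u)"

definition ball_prob ::
    "'a pair_pre_digraph \<Rightarrow> 'b pair_pre_digraph \<Rightarrow> 'b \<Rightarrow> nat \<Rightarrow> real" where
  "ball_prob G \<alpha> x r =
    measure_pmf.prob (pmf_of_set (pverts G))
      {v. rooted_iso (with_proj G \<restriction> ball_verts G v r) v (with_proj \<alpha>) x}"

text \<open>
  The test graphs range over graphs on natural numbers, which represent every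
  isomorphism class of finite graphs.
\<close>

definition BS_convergent :: "(nat \<Rightarrow> 'a pair_pre_digraph) \<Rightarrow> bool" where
  "BS_convergent G \<longleftrightarrow>
    (\<exists>D. \<forall>n. \<forall>v\<in>pverts (G n). out_degree (with_proj (G n)) v \<le> D) \<and>
    (\<forall>(\<alpha> :: nat pair_pre_digraph) x r.
      pair_graph \<alpha> \<longrightarrow> Digraph_Component.connected (with_proj \<alpha>) \<longrightarrow>
      x \<in> pverts \<alpha> \<longrightarrow> 0 < r \<longrightarrow>
      convergent (\<lambda>n. ball_prob (G n) \<alpha> x r))"


section \<open>The partition function\<close>

definition positive_definite :: "real ^ 'n ^ 'n \<Rightarrow> bool" where
  "positive_definite A \<longleftrightarrow> transpose A = A \<and> (\<forall>x. x \<noteq> 0 \<longrightarrow> 0 < x \<bullet> (A *v x))"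

text \<open>
  For symmetric matrices the weight of an undirected edge does not depend on the
  order of its endpoints, see \<open>edge_weight_doubleton\<close> below; for other matrices
  \<open>edge_weight\<close> is meaningless.
\<close>

definition edge_weight :: "real ^ 'c ^ 'c \<Rightarrow> ('a \<Rightarrow> 'c) \<Rightarrow> 'a set \<Rightarrow> real" where
  "edge_weight N \<sigma> e = (THE w. \<exists>u v. e = {u, v} \<and> w = N $ \<sigma> u $ \<sigma> v)"

lemma edge_weight_doubleton:
  assumes "transpose N = N"
  shows "edge_weight N \<sigma> {u, v} = N $ \<sigma> u $ \<sigma> v"
proof -
  have sym: "N $ i $ j = N $ j $ i" for i j
    by (metis assms transpose_def vec_lambda_beta)
  show ?thesis
    unfolding edge_weight_def
    by (rule the_equality) (auto simp: doubleton_eq_iff sym)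
qed

text \<open>The two spins are the two elements of the index type \<^typ>\<open>2\<close>.\<close>

definition partition_function :: "'a pair_pre_digraph \<Rightarrow> real ^ 2 ^ 2 \<Rightarrow> real ^ 2 \<Rightarrow> real" where
  "partition_function G N \<mu> =
    (\<Sum>\<sigma> \<in> pverts G \<rightarrow>\<^sub>E (UNIV :: 2 set).
      (\<Prod>v\<in>pverts G. \<mu> $ \<sigma> v) * (\<Prod>e\<in>edges G. edge_weight N \<sigma> e))"

end

theory Submission
  imports Defs "HOL-Complex_Analysis.Conformal_Mappings"
begin

text \<open>
  On a \<open>d\<close>-regular graph the diagonal of \<open>N\<close> can be absorbed into \<open>\<mu>\<close>, so \<open>Z\<close> becomes a
  constant to the power \<open>v(G)\<close> times the ferromagnetic Ising polynomial
  \<open>P(z) = \<Sum>S\<subseteq>V. w(S) z ^ card S\<close> at a point \<open>0 < t\<close>; exchanging the spins gives \<open>t \<le> 1\<close>.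
  For a vertex \<open>v\<close> write \<open>P = vac + z * occ\<close> according to whether \<open>v \<in> S\<close>. By the Lee--Yang
  theorem \<open>occ / vac\<close> is holomorphic and bounded by 1 on the unit disc. Passing from the graph to
  the \<open>r\<close>-ball around \<open>v\<close> changes this quotient only from order \<open>z ^ r\<close> on, hence by at most
  \<open>2 * t ^ r\<close> (Schwarz lemma). Since \<open>P' = \<Sum>v. occ\<close>, the free energy \<open>ln P(t)\<close> is a sum over the
  vertices of \<open>\<integral> occ / P\<close>, and each term is, up to \<open>2 * t ^ r\<close>, a function of the isomorphism
  class of the \<open>r\<close>-ball. This settles \<open>t < 1\<close>; the case \<open>t = 1\<close> follows because
  \<open>ln P(t) / v(G)\<close> is 1-Lipschitz in \<open>ln t\<close>.
\<close>

section \<open>The Lee--Yang theorem\<close>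

text \<open>
  Each undirected edge contributes two arcs, so \<open>b\<close> is the square root of the edge weight. Working
  with single arcs allows adding them one at a time in the Lee--Yang theorem.
\<close>

definition cut_weight :: "'k::comm_ring_1 \<Rightarrow> ('v \<times> 'v) set \<Rightarrow> 'v set \<Rightarrow> 'k" where
  "cut_weight b E S = (\<Prod>(x, y)\<in>E. if x \<in> S \<longleftrightarrow> y \<in> S then 1 else b)"

definition ising_poly :: "'k::comm_ring_1 \<Rightarrow> 'v set \<Rightarrow> ('v \<times> 'v) set \<Rightarrow> 'k \<Rightarrow> 'k" where
  "ising_poly b V E z = (\<Sum>S\<in>Pow V. cut_weight b E S * z ^ card S)"

text \<open>The factor \<open>z\<close> belonging to the root \<open>v\<close> itself is divided out in \<open>occ_poly\<close>.\<close>

definition occ_poly :: "'k::comm_ring_1 \<Rightarrow> 'v set \<Rightarrow> ('v \<times> 'v) set \<Rightarrow> 'v \<Rightarrow> 'k \<Rightarrow> 'k" where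
  "occ_poly b V E v z = (\<Sum>S | S \<subseteq> V \<and> v \<in> S. cut_weight b E S * z ^ (card S - 1))"

definition vac_poly :: "'k::comm_ring_1 \<Rightarrow> 'v set \<Rightarrow> ('v \<times> 'v) set \<Rightarrow> 'v \<Rightarrow> 'k \<Rightarrow> 'k" where
  "vac_poly b V E v z = (\<Sum>S | S \<subseteq> V \<and> v \<notin> S. cut_weight b E S * z ^ card S)"

text \<open>If \<open>g\<close> is not 0, both roots \<open>t1\<close>, \<open>t2\<close> lie
  outside the closed unit disc. A zero of the shrunk sum would force
  \<open>t1 * (t2 - b) = b * t2 - 1\<close>, and the right side is smaller in norm than
  \<open>t2 - b\<close> when \<open>norm t2 > 1\<close>, so \<open>norm t1 < 1\<close>. If
  \<open>g = 0\<close>, the sum is the value of the polynomial at \<open>t = b\<close>.\<close>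

lemma quadratic_shrink_nonzero:
  fixes a e g :: complex and b :: real
  assumes nz: "\<And>t. norm t \<le> 1 \<Longrightarrow> a + e * t + g * t\<^sup>2 \<noteq> 0" and b: "0 \<le> b" "b < 1"
  shows "a + of_real b * e + g \<noteq> 0"
proof (cases "g = 0")
  case True
  show ?thesis
    using nz[of "of_real b"] True b by (simp add: mult.commute)
next
  case False
  define s where "s = csqrt (e\<^sup>2 - 4 * a * g)"
  have s2: "s\<^sup>2 = e\<^sup>2 - 4 * a * g" by (simp add: s_def)
  define t1 where "t1 = (- e + s) / (2 * g)"
  define t2 where "t2 = (- e - s) / (2 * g)"
  have sum: "g * (t1 + t2) = - e" using False by (simp add: t1_def t2_def field_simps)
  then have e_eq: "e = - (g * (t1 + t2))" by simp
  have prd: "g * (t1 * t2) = a"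
  proof -
    have "g * (t1 * t2) = (e\<^sup>2 - s\<^sup>2) / (4 * g)"
      using False by (simp add: t1_def t2_def field_simps power2_eq_square)
    then show ?thesis using False by (simp add: s2)
  qed
  have fact: "a + e * t + g * t\<^sup>2 = g * ((t - t1) * (t - t2))" for t
    unfolding prd[symmetric] e_eq
    by (simp add: algebra_simps power2_eq_square)
  have t1: "norm t1 > 1" using nz[of t1] fact[of t1] by fastforce
  have t2: "norm t2 > 1" using nz[of t2] fact[of t2] by fastforce
  show ?thesis
  proof
    assume "a + of_real b * e + g = 0"
    then have "g * (t1 * (t2 - of_real b) - (of_real b * t2 - 1)) = 0"
      unfolding prd[symmetric] e_eq
      by (simp add: algebra_simps)
    then have eq: "t1 * (t2 - of_real b) = of_real b * t2 - 1" using False by simp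
    have "(norm (t2 - of_real b))\<^sup>2 - (norm (of_real b * t2 - 1))\<^sup>2 = ((norm t2)\<^sup>2 - 1) * (1 - b\<^sup>2)"
      unfolding cmod_power2 by (simp add: algebra_simps power2_eq_square)
    moreover have "((norm t2)\<^sup>2 - 1) * (1 - b\<^sup>2) > 0"
      using t2 b by (intro mult_pos_pos) (simp_all add: power_less_one_iff one_less_power abs_square_less_1)
    ultimately have "(norm (of_real b * t2 - 1))\<^sup>2 < (norm (t2 - of_real b))\<^sup>2" by linarith
    then have lt: "norm (of_real b * t2 - 1) < norm (t2 - of_real b)"
      by (rule power_less_imp_less_base) simp
    have "norm (t2 - of_real b) \<le> norm t1 * norm (t2 - of_real b)"
      using t1 mult_right_mono[of 1 "norm t1" "norm (t2 - of_real b)"] by simp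
    also have "\<dots> = norm (of_real b * t2 - 1)" by (simp only: eq[symmetric] norm_mult)
    finally show False using lt by simp
  qed
qed

text \<open>
  Scaling the variables at the endpoints of a new arc by a common factor \<open>t\<close> turns the polynomial
  into a quadratic in \<open>t\<close> whose middle coefficient is multiplied by \<open>b\<close>.
\<close>

theorem lee_yang:
  fixes z :: "'v \<Rightarrow> complex" and b :: real
  assumes "finite V" "finite E" "0 \<le> b" "b < 1"
    and "\<And>i. i \<in> V \<Longrightarrow> norm (z i) < 1" "E \<subseteq> V \<times> V"
  shows "(\<Sum>S\<in>Pow V. cut_weight (of_real b) E S * prod z S) \<noteq> 0"
  using assms(2,5,6)
proof (induction E arbitrary: z rule: finite_induct)
  case empty
  have "(\<Sum>S\<in>Pow V. cut_weight (of_real b) {} S * prod z S) = (\<Prod>i\<in>V. z i + 1)"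
    using \<open>finite V\<close> by (subst prod_add) (simp_all add: cut_weight_def)
  moreover have "z i + 1 \<noteq> 0" if "i \<in> V" for i
    using empty(1)[OF that] by (metis add_eq_0_iff less_irrefl norm_minus_cancel norm_one)
  ultimately show ?case using \<open>finite V\<close> by simp
next
  case (insert xy E)
  obtain x y where xy: "xy = (x, y)" by fastforce
  define c where "c = (\<lambda>S. cut_weight (of_real b :: complex) E S)"
  define n where "n = (\<lambda>S. card (S \<inter> {x, y}))"
  have ins: "cut_weight (of_real b) (insert xy E) S = (if x \<in> S \<longleftrightarrow> y \<in> S then 1 else of_real b) * c S" for S
    using insert.hyps by (simp add: cut_weight_def c_def xy)
  show ?case
  proof (cases "x = y")
    \<comment> \<open>A loop is never cut, so it leaves the polynomial unchanged.\<close>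
    case True
    then show ?thesis using insert by (simp add: ins c_def)
  next
    case False
    define part where "part = (\<lambda>k. \<Sum>S | S \<subseteq> V \<and> n S = k. c S * prod z S)"
    have split: "(\<Sum>S\<in>Pow V. f (n S) * (c S * prod z S)) = f 0 * part 0 + f 1 * part 1 + f 2 * part 2"
      for f :: "nat \<Rightarrow> complex"
    proof -
      have "n S \<le> card {x, y}" for S unfolding n_def by (intro card_mono) auto
      moreover have "card {x, y} = 2" using False by simp
      ultimately have "n S \<in> {..2}" for S by (metis atMost_iff)
      then have "(\<Sum>S\<in>Pow V. f (n S) * (c S * prod z S))
          = (\<Sum>k\<in>{..2}. \<Sum>S | S \<in> Pow V \<and> n S = k. f (n S) * (c S * prod z S))"
        using \<open>finite V\<close> by (intro sum.group[symmetric]) auto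
      also have "\<dots> = (\<Sum>k\<in>{..2}. f k * part k)"
        by (simp add: part_def sum_distrib_left)
      finally show ?thesis by (simp add: numeral_2_eq_2)
    qed
    \<comment> \<open>The induction hypothesis is used at the scaled variables \<open>z'\<close>,
      which stay in the open disc. This is why every vertex carries its own variable.\<close>
    have nz: "part 0 + part 1 * t + part 2 * t\<^sup>2 \<noteq> 0" if "norm t \<le> 1" for t
    proof -
      define z' where "z' = (\<lambda>i. (if i \<in> {x, y} then t else 1) * z i)"
      have "norm (z' i) < 1" if "i \<in> V" for i
        using insert.prems(1)[OF that] \<open>norm t \<le> 1\<close>
        by (auto simp: z'_def norm_mult intro: le_less_trans[OF mult_left_le_one_le])
      then have "(\<Sum>S\<in>Pow V. c S * prod z' S) \<noteq> 0"
        unfolding c_def using insert by auto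
      moreover have "c S * prod z' S = t ^ n S * (c S * prod z S)" if "S \<in> Pow V" for S
      proof -
        have "finite S" using that \<open>finite V\<close> by (auto dest: finite_subset)
        then have "prod z' S = (\<Prod>i\<in>S \<inter> {x,y}. t) * prod z S"
          by (simp add: z'_def prod.distrib prod.inter_restrict del: prod_constant)
        then show ?thesis by (simp add: n_def)
      qed
      ultimately show ?thesis by (simp add: split mult.commute)
    qed
    \<comment> \<open>The new arc is cut exactly when one of its two endpoints lies in
      \<open>S\<close>, so only the linear coefficient acquires the factor \<open>b\<close>.\<close>
    have n1: "(if x \<in> S \<longleftrightarrow> y \<in> S then 1 else of_real b) = (if n S = 1 then of_real b else (1::complex))" for S
      using False by (auto simp: n_def Int_insert_right)
    have "(\<Sum>S\<in>Pow V. cut_weight (of_real b) (insert xy E) S * prod z S)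
      = (\<Sum>S\<in>Pow V. (if n S = 1 then of_real b else 1) * (c S * prod z S))"
      unfolding ins n1 by (simp add: mult.assoc)
    also have "\<dots> = part 0 + of_real b * part 1 + part 2"
      by (subst split[of "\<lambda>k. if k = 1 then of_real b else 1"]) simp
    finally show ?thesis
      using quadratic_shrink_nonzero[OF nz, of b] assms(3,4) by simp
  qed
qed

section \<open>The quotient of the occupied and vacant parts at a vertex\<close>

lemma sum_Pow_split_point:
  assumes "finite V"
  shows "(\<Sum>S\<in>Pow V. f S) = (\<Sum>S | S \<subseteq> V \<and> v \<notin> S. f S) + (\<Sum>S | S \<subseteq> V \<and> v \<in> S. f S)"
proof -
  have "Pow V = {S. S \<subseteq> V \<and> v \<notin> S} \<union> {S. S \<subseteq> V \<and> v \<in> S}" by auto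
  then show ?thesis
    using assms by (simp add: sum.union_disjoint[symmetric] disjoint_iff)
qed

lemma ising_poly_split:
  assumes "finite V"
  shows "ising_poly b V E z = vac_poly b V E v z + z * occ_poly b V E v z"
proof -
  have "card S > 0" if "S \<subseteq> V" "v \<in> S" for S
    using that assms by (metis card_gt_0_iff empty_iff finite_subset)
  then have "z * z ^ (card S - 1) = z ^ card S" if "S \<subseteq> V" "v \<in> S" for S
    using that by (metis power_eq_if less_irrefl)
  then have "z * occ_poly b V E v z = (\<Sum>S | S \<subseteq> V \<and> v \<in> S. cut_weight b E S * z ^ card S)"
    unfolding occ_poly_def sum_distrib_left by (intro sum.cong refl) (subst mult.left_commute, auto)
  then show ?thesis
    unfolding ising_poly_def vac_poly_def by (subst sum_Pow_split_point[OF assms, of _ v]) simp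
qed

text \<open>Give the root its own variable \<open>y\<close> and all other vertices the variable
  \<open>z\<close>. The polynomial becomes \<open>vac + y * occ\<close>, which by
  \<open>lee_yang\<close> has no zero with \<open>norm y < 1\<close>. Taking \<open>y = 0\<close>
  gives the first claim; for the second, \<open>- vac / occ\<close> would be a zero in the
  disc.\<close>

lemma vac_nonzero_occ_le_vac:
  fixes z :: complex and b :: real
  assumes "finite V" "E \<subseteq> V \<times> V" "0 \<le> b" "b < 1" "norm z < 1" "v \<in> V"
  shows "vac_poly (of_real b) V E v z \<noteq> 0"
    and "norm (occ_poly (of_real b) V E v z) \<le> norm (vac_poly (of_real b) V E v z)"
proof -
  let ?A = "vac_poly (of_real b) V E v z" and ?B = "occ_poly (of_real b) V E v z"
  have fE: "finite E" using assms(1,2) by (meson finite_SigmaI finite_subset)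
  have nz: "?A + y * ?B \<noteq> 0" if "norm y < 1" for y
  proof -
    let ?z = "(\<lambda>_. z)(v := y)"
    have vac: "prod ?z S = z ^ card S" if "S \<subseteq> V" "v \<notin> S" for S
      using that by (subst prod.cong[OF refl, of _ _ "\<lambda>_. z"]) auto
    have occ: "prod ?z S = y * z ^ (card S - 1)" if "S \<subseteq> V" "v \<in> S" for S
    proof -
      have "finite S" using that assms(1) finite_subset by auto
      then have "prod ?z S = y * prod ?z (S - {v})" using that by (simp add: prod.remove)
      also have "prod ?z (S - {v}) = z ^ card (S - {v})"
        by (subst prod.cong[OF refl, of _ _ "\<lambda>_. z"]) auto
      finally show ?thesis using that \<open>finite S\<close> by simp
    qed
    have "(\<Sum>S\<in>Pow V. cut_weight (of_real b) E S * prod ?z S) = ?A + y * ?B"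
      unfolding sum_Pow_split_point[OF assms(1), of _ v] vac_poly_def occ_poly_def
        sum_distrib_left
      by (intro arg_cong2[where f="(+)"] sum.cong) (auto simp: vac occ mult.left_commute simp del: fun_upd_apply)
    moreover have "(\<Sum>S\<in>Pow V. cut_weight (of_real b) E S * prod ?z S) \<noteq> 0"
      by (rule lee_yang[OF assms(1) fE assms(3,4) _ assms(2)]) (use that assms(5) in auto)
    ultimately show ?thesis by simp
  qed
  show "?A \<noteq> 0" using nz[of 0] by simp
  show "norm ?B \<le> norm ?A"
  proof (rule ccontr)
    assume "\<not> ?thesis"
    then have lt: "norm ?A < norm ?B" by simp
    then have "?B \<noteq> 0" by auto
    then show False using nz[of "- ?A / ?B"] lt by (simp add: norm_divide divide_less_eq)
  qed
qed

section \<open>Locality\<close>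

lemma cut_weight_split:
  assumes "finite E" "A \<subseteq> E"
  shows "cut_weight b E S = cut_weight b A S * cut_weight b (E - A) S"
  unfolding cut_weight_def using assms by (metis (no_types) mult.commute prod.subset_diff)

lemma cut_weight_cong:
  assumes "\<And>x y. (x, y) \<in> E \<Longrightarrow> (x \<in> S \<longleftrightarrow> y \<in> S) \<longleftrightarrow> (x \<in> T \<longleftrightarrow> y \<in> T)"
  shows "cut_weight b E S = cut_weight b E T"
  unfolding cut_weight_def using assms by (intro prod.cong refl) (auto split: prod.splits)

definition swap_on :: "'v set \<Rightarrow> 'v set \<times> 'v set \<Rightarrow> 'v set \<times> 'v set" where
  "swap_on K = (\<lambda>(S, T). ((S - K) \<union> (T \<inter> K), (T - K) \<union> (S \<inter> K)))"

lemma card_swap_on: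
  assumes "finite S" "finite T"
  shows "card ((S - K) \<union> (T \<inter> K)) + card ((T - K) \<union> (S \<inter> K)) = card S + card T"
proof -
  have "card ((S - K) \<union> (T \<inter> K)) = card (S - K) + card (T \<inter> K)"
    "card ((T - K) \<union> (S \<inter> K)) = card (T - K) + card (S \<inter> K)"
    using assms by (auto intro!: card_Un_disjoint)
  moreover have "card S = card (S \<inter> K) + card (S - K)" "card T = card (T \<inter> K) + card (T - K)"
    using assms by (auto simp: card_Int_Diff)
  ultimately show ?thesis by simp
qed

text \<open>Let \<open>A\<close> be the arcs touching \<open>K\<close>; all of them belong to both
  \<open>E\<close> and \<open>F\<close>. Neighbours of \<open>K\<close> outside \<open>K\<close> lie
  in neither set, so on \<open>A\<close> the new first set cuts like \<open>T\<close> and the new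
  second set like \<open>S\<close>. Away from \<open>A\<close> nothing changes. The two
  \<open>A\<close> factors therefore just trade places.\<close>

lemma cut_weight_swap_on:
  assumes "finite E" "sym E" "F \<subseteq> E"
    and inF: "\<And>x y. (x, y) \<in> E \<Longrightarrow> x \<in> K \<Longrightarrow> (x, y) \<in> F \<and> (y, x) \<in> F"
    and out: "\<And>x y. (x, y) \<in> E \<Longrightarrow> x \<in> K \<Longrightarrow> y \<notin> K \<Longrightarrow> y \<notin> S \<union> T"
  shows "cut_weight b E ((S - K) \<union> (T \<inter> K)) * cut_weight b F ((T - K) \<union> (S \<inter> K))
    = cut_weight b E S * cut_weight b F T"
proof -
  let ?S = "(S - K) \<union> (T \<inter> K)" and ?T = "(T - K) \<union> (S \<inter> K)"
  define A where "A = {(x, y). (x, y) \<in> E \<and> (x \<in> K \<or> y \<in> K)}"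
  have A: "A \<subseteq> E" "A \<subseteq> F" using inF \<open>sym E\<close> by (auto simp: A_def dest: symD)
  have fF: "finite F" using assms(1,3) by (rule finite_subset[rotated])
  have out': "y \<notin> S \<union> T" if "(y, x) \<in> E" "x \<in> K" "y \<notin> K" for x y
    using out[of x y] that \<open>sym E\<close> by (auto dest: symD)
  have "cut_weight b A ?S = cut_weight b A T" "cut_weight b A ?T = cut_weight b A S"
    by (rule cut_weight_cong; use out out' in \<open>auto simp: A_def\<close>)+
  moreover have "cut_weight b (E - A) ?S = cut_weight b (E - A) S"
    "cut_weight b (F - A) ?T = cut_weight b (F - A) T"
    by (rule cut_weight_cong; use \<open>F \<subseteq> E\<close> in \<open>auto simp: A_def\<close>)+
  ultimately show ?thesis
    by (simp add: cut_weight_split[OF assms(1) A(1)] cut_weight_split[OF fF A(2)])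
qed

text \<open>Pigeonhole: \<open>v\<close> lies in \<open>B 0\<close>, so at most \<open>r - 1\<close>
  points of \<open>X\<close> remain for \<open>r\<close> disjoint spheres.\<close>

lemma exists_empty_sphere:
  assumes "finite X" "card X \<le> r" "v \<in> X" "v \<in> B 0" "mono B"
  shows "\<exists>m<r. X \<inter> (B (Suc m) - B m) = {}"
proof (rule ccontr)
  assume "\<not> ?thesis"
  then have ne: "X \<inter> (B (Suc m) - B m) \<noteq> {}" if "m < r" for m using that by blast
  have "Suc n \<le> card (X \<inter> B n)" if "n \<le> r" for n
    using that
  proof (induction n)
    case 0
    then show ?case using assms by (auto simp: Suc_le_eq card_gt_0_iff)
  next
    case (Suc n)
    then have "X \<inter> B n \<subset> X \<inter> B (Suc n)"
      using ne[of n] monoD[OF \<open>mono B\<close>, of n "Suc n"] by auto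
    then have "card (X \<inter> B n) < card (X \<inter> B (Suc n))" using assms(1) by (intro psubset_card_mono) auto
    then show ?case using Suc by simp
  qed
  from this[of r] have "Suc r \<le> card X"
    using card_mono[of X "X \<inter> B r"] assms(1) by simp
  then show False using assms(2) by simp
qed

text \<open>
  Expand both products as sums over pairs \<open>(S, T)\<close>. If \<open>card S + card T \<le> r\<close>, some sphere around
  \<open>v\<close> inside the \<open>r\<close>-ball misses \<open>S \<union> T\<close>, and exchanging \<open>S\<close> and \<open>T\<close> inside the first such
  sphere is a weight-preserving bijection between the terms of the two products.
\<close>

theorem occ_vac_ball:
  fixes b :: "'k::comm_ring_1" and B :: "nat \<Rightarrow> 'v set"
  assumes "finite V" "E \<subseteq> V \<times> V" "sym E" "B 0 = {v}" "mono B" "B r \<subseteq> V"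
    and nb: "\<And>n. E `` B n \<subseteq> B (Suc n)"
  shows "\<exists>p. \<forall>z. occ_poly b V E v z * vac_poly b (B r) (E \<inter> B r \<times> B r) v z
      - vac_poly b V E v z * occ_poly b (B r) (E \<inter> B r \<times> B r) v z = z ^ r * poly p z"
proof -
  define U where "U = B r"
  define F where "F = E \<inter> U \<times> U"
  define I where "I = {S. S \<subseteq> V \<and> v \<in> S} \<times> {T. T \<subseteq> U \<and> v \<notin> T}"
  define J where "J = {S. S \<subseteq> V \<and> v \<notin> S} \<times> {T. T \<subseteq> U \<and> v \<in> T}"
  \<comment> \<open>A pair outside \<open>small\<close> has \<open>card S + card T > r\<close>. Its
    exponent \<open>n\<close> is one less, as the factor of the root is divided out, hence at least
    \<open>r\<close>. These terms supply the polynomial behind \<open>z ^ r\<close>.\<close>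
  define small where "small = {(S :: 'v set, T :: 'v set). card S + card T \<le> r}"
  define c where "c = (\<lambda>(S, T). cut_weight b E S * cut_weight b F T)"
  define n where "n = (\<lambda>(S :: 'v set, T :: 'v set). card S + card T - 1)"
  \<comment> \<open>The level depends only on the union \<open>S \<union> T\<close>, which swapping
    preserves. Hence the swapped pair has the same level and \<open>sw\<close> is its own
    inverse.\<close>
  define level where "level = (\<lambda>X. LEAST m. X \<inter> (B (Suc m) - B m) = {})"
  define sw where "sw = (\<lambda>(S, T). swap_on (B (level (S \<union> T))) (S, T))"
  have fin: "finite U" "finite E"
    using assms(1,2,6) by (auto simp: U_def intro: finite_subset)
  have fIJ: "finite I" "finite J" using assms(1) fin by (auto simp: I_def J_def)
  have BU: "B k \<subseteq> U" if "k \<le> r" for k using monoD[OF \<open>mono B\<close> that] by (simp add: U_def)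
  have vB: "v \<in> B k" for k using monoD[OF \<open>mono B\<close>, of 0 k] assms(4) by auto
  have level: "level (S \<union> T) < r" "(S \<union> T) \<inter> (B (Suc (level (S \<union> T))) - B (level (S \<union> T))) = {}"
    if "(S, T) \<in> (I \<union> J) \<inter> small" for S T
  proof -
    have "finite (S \<union> T)" using that assms(1) fin
      by (auto simp: I_def J_def intro: finite_subset)
    moreover have "card (S \<union> T) \<le> r" using that card_Un_le[of S T] by (auto simp: small_def)
    moreover have "v \<in> S \<union> T" using that by (auto simp: I_def J_def)
    ultimately obtain m where m: "m < r" "(S \<union> T) \<inter> (B (Suc m) - B m) = {}"
      using exists_empty_sphere[of "S \<union> T" r v B] assms(4,5) by auto
    show "level (S \<union> T) < r"
      unfolding level_def by (rule le_less_trans[OF Least_le m(1)]) (rule m(2))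
    show "(S \<union> T) \<inter> (B (Suc (level (S \<union> T))) - B (level (S \<union> T))) = {}"
      unfolding level_def by (rule LeastI) (rule m(2))
  qed
  have sw_props: "sw (sw (S, T)) = (S, T)" "c (sw (S, T)) = c (S, T)" "n (sw (S, T)) = n (S, T)"
    "sw (S, T) \<in> small" "(S, T) \<in> I \<Longrightarrow> sw (S, T) \<in> J" "(S, T) \<in> J \<Longrightarrow> sw (S, T) \<in> I"
    if ST: "(S, T) \<in> (I \<union> J) \<inter> small" for S T
  proof -
    let ?k = "level (S \<union> T)"
    let ?S = "(S - B ?k) \<union> (T \<inter> B ?k)" and ?T = "(T - B ?k) \<union> (S \<inter> B ?k)"
    have sw: "sw (S, T) = (?S, ?T)" by (simp add: sw_def swap_on_def)
    have un: "?S \<union> ?T = S \<union> T" by auto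
    have "sw (?S, ?T) = swap_on (B ?k) (?S, ?T)" unfolding sw_def prod.case un ..
    then show "sw (sw (S, T)) = (S, T)"
      unfolding sw by (auto simp: swap_on_def)
    have sub: "S \<subseteq> V" "T \<subseteq> U" using ST by (auto simp: I_def J_def)
    have fST: "finite S" "finite T" using sub assms(1) fin by (auto intro: finite_subset)
    note cards = card_swap_on[OF fST, of "B ?k"]
    show "n (sw (S, T)) = n (S, T)" by (simp add: sw n_def cards)
    show "sw (S, T) \<in> small" using ST by (simp add: sw small_def cards)
    have "B ?k \<subseteq> U" "U \<subseteq> V" using BU level(1)[OF ST] assms(6) by (auto simp: U_def)
    then show "(S, T) \<in> I \<Longrightarrow> sw (S, T) \<in> J" "(S, T) \<in> J \<Longrightarrow> sw (S, T) \<in> I"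
      using sub vB by (auto simp: sw I_def J_def)
    \<comment> \<open>Since the level is below \<open>r\<close>, the ball at the level and all its
      neighbours lie in \<open>U\<close>, so every arc of \<open>E\<close> touching that ball
      survives in \<open>F\<close>.\<close>
    have "(x, y) \<in> F \<and> (y, x) \<in> F" if "(x, y) \<in> E" "x \<in> B ?k" for x y
      using that nb[of ?k] BU[of "Suc ?k"] BU[of ?k] level(1)[OF ST] \<open>sym E\<close>
      by (auto simp: F_def dest: symD)
    moreover have "y \<notin> S \<union> T" if "(x, y) \<in> E" "x \<in> B ?k" "y \<notin> B ?k" for x y
      using that nb[of ?k] level(2)[OF ST] by auto
    ultimately show "c (sw (S, T)) = c (S, T)"
      unfolding sw c_def prod.case
      by (intro cut_weight_swap_on fin(2) assms(3)) (auto simp: F_def)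
  qed
  have cancel: "(\<Sum>p\<in>I \<inter> small. c p * z ^ n p) = (\<Sum>p\<in>J \<inter> small. c p * z ^ n p)" for z
    by (rule sum.reindex_bij_witness[of _ sw sw]) (auto simp: sw_props)
  have split: "(\<Sum>p\<in>K. c p * z ^ n p) = (\<Sum>p\<in>K \<inter> small. c p * z ^ n p)
      + z ^ r * poly (\<Sum>p\<in>K - small. monom (c p) (n p - r)) z" if "finite K" for K z
  proof -
    have "z ^ n p = z ^ r * z ^ (n p - r)" if "p \<in> K - small" for p
    proof -
      have "r \<le> n p" using that by (auto simp: small_def n_def)
      then show ?thesis by (metis le_add_diff_inverse power_add)
    qed
    then have "(\<Sum>p\<in>K - small. c p * z ^ n p) = z ^ r * poly (\<Sum>p\<in>K - small. monom (c p) (n p - r)) z"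
      by (simp add: poly_sum poly_monom sum_distrib_left mult.left_commute)
    then show ?thesis by (subst sum.Int_Diff[OF that, of _ small]) simp
  qed
  have "occ_poly b V E v z * vac_poly b U F v z = (\<Sum>p\<in>I. c p * z ^ n p)" for z
    unfolding occ_poly_def vac_poly_def sum_product sum.cartesian_product I_def
  proof (intro sum.cong refl, clarify)
    fix S T :: "'v set" assume "S \<subseteq> V" "v \<in> S"
    then have "card S > 0" using assms(1) by (metis card_gt_0_iff empty_iff finite_subset)
    then have "card S + card T - 1 = (card S - 1) + card T" by simp
    then show "cut_weight b E S * z ^ (card S - 1) * (cut_weight b F T * z ^ card T) = c (S, T) * z ^ n (S, T)"
      unfolding n_def c_def prod.case by (simp only: power_add mult_ac)
  qed
  moreover have "vac_poly b V E v z * occ_poly b U F v z = (\<Sum>p\<in>J. c p * z ^ n p)" for z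
    unfolding occ_poly_def vac_poly_def sum_product sum.cartesian_product J_def
  proof (intro sum.cong refl, clarify)
    fix S T :: "'v set" assume "T \<subseteq> U" "v \<in> T"
    then have "card T > 0" using fin(1) by (metis card_gt_0_iff empty_iff finite_subset)
    then have "card S + card T - 1 = card S + (card T - 1)" by simp
    then show "cut_weight b E S * z ^ card S * (cut_weight b F T * z ^ (card T - 1)) = c (S, T) * z ^ n (S, T)"
      unfolding n_def c_def prod.case by (simp only: power_add mult_ac)
  qed
  ultimately have "occ_poly b V E v z * vac_poly b U F v z - vac_poly b V E v z * occ_poly b U F v z
    = z ^ r * poly ((\<Sum>p\<in>I - small. monom (c p) (n p - r)) - (\<Sum>p\<in>J - small. monom (c p) (n p - r))) z" for z
    by (simp add: split[OF fIJ(1)] split[OF fIJ(2)] cancel right_diff_distrib)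
  then show ?thesis unfolding U_def F_def by blast
qed

section \<open>The free energy as a sum of local terms\<close>

text \<open>The Schwarz lemma for a zero of order \<open>r\<close>, with the quotient
  \<open>k\<close> given explicitly. The maximum principle on circles of radius
  \<open>\<rho> < 1\<close> gives \<open>norm (k z) \<le> C / \<rho> ^ r\<close>; then
  \<open>\<rho>\<close> tends to 1.\<close>

lemma holomorphic_zero_order_bound:
  assumes hol: "k holomorphic_on ball 0 1"
    and bd: "\<And>w. norm w < 1 \<Longrightarrow> norm (w ^ r * k w) \<le> C"
    and z: "norm z < 1"
  shows "norm (z ^ r * k z) \<le> C * norm z ^ r"
proof -
  have le: "\<rho> ^ r * norm (k z) \<le> C" if \<rho>: "norm z < \<rho>" "\<rho> < 1" for \<rho>
  proof -
    have "\<rho> > 0" using \<rho>(1) norm_ge_zero[of z] by linarith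
    have "norm (k z) \<le> C / \<rho> ^ r"
    proof (rule maximum_modulus_frontier[of k "ball 0 \<rho>"])
      show "k holomorphic_on interior (ball 0 \<rho>)"
        using \<rho> by (auto intro: holomorphic_on_subset[OF hol])
      show "continuous_on (closure (ball 0 \<rho>)) k"
        using \<rho> \<open>\<rho> > 0\<close> by (auto intro!: holomorphic_on_imp_continuous_on holomorphic_on_subset[OF hol])
      show "norm (k w) \<le> C / \<rho> ^ r" if "w \<in> frontier (ball 0 \<rho>)" for w
        using bd[of w] that \<rho> \<open>\<rho> > 0\<close>
        by (simp add: frontier_ball norm_mult norm_power le_divide_eq mult.commute)
    qed (use \<rho> in auto)
    then show ?thesis using \<open>\<rho> > 0\<close> by (simp add: le_divide_eq mult.commute)
  qed
  have "((\<lambda>\<rho>. \<rho> ^ r * norm (k z)) \<longlongrightarrow> 1 ^ r * norm (k z)) (at_left 1)"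
    by (intro tendsto_intros)
  moreover have "\<forall>\<^sub>F \<rho> in at_left 1. \<rho> ^ r * norm (k z) \<le> C"
    using eventually_at_left_real[OF z] by eventually_elim (use le in auto)
  ultimately have "norm (k z) \<le> C" by (metis tendsto_upperbound power_one mult_1 trivial_limit_at_left_real)
  then show ?thesis by (simp add: norm_mult norm_power mult.commute mult_right_mono)
qed

section \<open>From the complex disc to real activities\<close>

lemma of_real_cut_weight:
  "of_real (cut_weight b E S) = (cut_weight (of_real b) E S :: complex)"
  unfolding cut_weight_def of_real_prod by (intro prod.cong) auto

lemma of_real_occ_poly: "of_real (occ_poly b V E v t) = (occ_poly (of_real b) V E v (of_real t) :: complex)"
  and of_real_vac_poly: "of_real (vac_poly b V E v t) = (vac_poly (of_real b) V E v (of_real t) :: complex)"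
  by (simp_all add: occ_poly_def vac_poly_def of_real_cut_weight)

lemma holomorphic_occ_poly: "occ_poly b V E v holomorphic_on A"
  and holomorphic_vac_poly: "vac_poly b V E v holomorphic_on A"
  unfolding occ_poly_def[abs_def] vac_poly_def[abs_def] by (intro holomorphic_intros)+

lemma cut_weight_nonneg: "0 \<le> b \<Longrightarrow> 0 \<le> cut_weight (b :: real) E S"
  unfolding cut_weight_def by (intro prod_nonneg) auto

lemma cut_weight_empty: "cut_weight b E {} = 1"
  by (simp add: cut_weight_def case_prod_unfold)

lemma occ_poly_nonneg: "0 \<le> b \<Longrightarrow> 0 \<le> t \<Longrightarrow> 0 \<le> occ_poly (b :: real) V E v t"
  unfolding occ_poly_def by (intro sum_nonneg mult_nonneg_nonneg cut_weight_nonneg zero_le_power)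

lemma vac_poly_ge_1:
  assumes "finite V" "0 \<le> b" "0 \<le> t"
  shows "1 \<le> vac_poly (b :: real) V E v t"
proof -
  have "cut_weight b E {} * t ^ card ({} :: 'a set) \<le> vac_poly b V E v t"
    unfolding vac_poly_def using assms by (intro member_le_sum) (auto simp: cut_weight_nonneg)
  then show ?thesis by (simp add: cut_weight_empty)
qed

lemma ising_poly_ge_1:
  assumes "finite V" "0 \<le> b" "0 \<le> t"
  shows "1 \<le> ising_poly (b :: real) V E t"
proof -
  have "cut_weight b E {} * t ^ card ({} :: 'a set) \<le> ising_poly b V E t"
    unfolding ising_poly_def using assms by (intro member_le_sum) (auto simp: cut_weight_nonneg)
  then show ?thesis by (simp add: cut_weight_empty)
qed

context
  fixes b :: real and V :: "'v set" and E :: "('v \<times> 'v) set" and B :: "nat \<Rightarrow> 'v set"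
    and v :: 'v and r :: nat
  assumes b: "0 \<le> b" "b < 1"
    and graph: "finite V" "E \<subseteq> V \<times> V" "sym E"
    and ball: "B 0 = {v}" "mono B" "B r \<subseteq> V" "\<And>n. E `` B n \<subseteq> B (Suc n)"
begin

private abbreviation (input) "F \<equiv> E \<inter> B r \<times> B r"

text \<open>The remainder polynomial of \<open>occ_vac_ball\<close>, divided by both vacant parts,
  is holomorphic on the disc because these have no zeros there. Each quotient is bounded by 1, so
  their difference is bounded by 2 and the Schwarz bound applies.\<close>

lemma occ_vac_ratio_ball:
  assumes t: "0 \<le> t" "t < 1"
  shows "\<bar>occ_poly b V E v t / vac_poly b V E v t
    - occ_poly b (B r) F v t / vac_poly b (B r) F v t\<bar> \<le> 2 * t ^ r"
proof -
  let ?b = "of_real b :: complex"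
  let ?o = "occ_poly ?b V E v" and ?a = "vac_poly ?b V E v"
  let ?o' = "occ_poly ?b (B r) F v" and ?a' = "vac_poly ?b (B r) F v"
  have v: "v \<in> B r" using ball(1) monoD[OF ball(2), of 0 r] by auto
  have fB: "finite (B r)" using ball(3) graph(1) by (rule finite_subset)
  obtain p where p: "?o z * ?a' z - ?a z * ?o' z = z ^ r * poly p z" for z
    using occ_vac_ball[OF graph ball] by blast
  have nz: "?a z \<noteq> 0" "?a' z \<noteq> 0" and le: "norm (?o z) \<le> norm (?a z)" "norm (?o' z) \<le> norm (?a' z)"
    if "norm z < 1" for z
    using vac_nonzero_occ_le_vac[OF graph(1,2) b that, of v]
      vac_nonzero_occ_le_vac[OF fB _ b that v, of F] v ball(3) by auto
  define k where "k = (\<lambda>z. poly p z / (?a z * ?a' z))"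
  have k: "z ^ r * k z = ?o z / ?a z - ?o' z / ?a' z" if "norm z < 1" for z
    using nz[OF that] p[of z] by (simp add: k_def field_simps)
  have "norm (of_real t ^ r * k (of_real t)) \<le> 2 * norm (of_real t :: complex) ^ r"
  proof (rule holomorphic_zero_order_bound)
    show "k holomorphic_on ball 0 1"
      unfolding k_def using nz
      by (intro holomorphic_intros holomorphic_vac_poly) auto
    show "norm (w ^ r * k w) \<le> 2" if "norm w < 1" for w
    proof -
      have "norm (?o w / ?a w) \<le> 1" "norm (?o' w / ?a' w) \<le> 1"
        using nz[OF that] le[OF that] by (simp_all add: norm_divide divide_le_eq)
      then show ?thesis unfolding k[OF that]
        using norm_triangle_ineq4[of "?o w / ?a w" "?o' w / ?a' w"] by linarith
    qed
  qed (use t in simp)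
  also have "of_real t ^ r * k (of_real t) = of_real (occ_poly b V E v t / vac_poly b V E v t
    - occ_poly b (B r) F v t / vac_poly b (B r) F v t)"
    using t by (subst k) (simp_all add: of_real_occ_poly of_real_vac_poly)
  finally show ?thesis using t by (simp only: norm_of_real abs_of_nonneg)
qed

text \<open>In terms of \<open>q = occ / vac\<close> the ratio is \<open>q / (1 + t * q)\<close>,
  and this map is 1-Lipschitz for \<open>q \<ge> 0\<close>.\<close>

lemma occ_ising_ratio_ball:
  assumes t: "0 \<le> t" "t < 1"
  shows "\<bar>occ_poly b V E v t / ising_poly b V E t
    - occ_poly b (B r) F v t / ising_poly b (B r) F t\<bar> \<le> 2 * t ^ r"
proof -
  have fB: "finite (B r)" using ball(3) graph(1) by (rule finite_subset)
  define q where "q = occ_poly b V E v t / vac_poly b V E v t"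
  define q' where "q' = occ_poly b (B r) F v t / vac_poly b (B r) F v t"
  have a: "vac_poly b V E v t > 0" "vac_poly b (B r) F v t > 0"
    using vac_poly_ge_1[OF graph(1) b(1) t(1), of E v] vac_poly_ge_1[OF fB b(1) t(1), of F v] by linarith+
  have q: "q \<ge> 0" "q' \<ge> 0"
    unfolding q_def q'_def using a by (auto intro!: divide_nonneg_pos occ_poly_nonneg b t)
  have "occ_poly b V E v t / ising_poly b V E t = q / (1 + t * q)"
    "occ_poly b (B r) F v t / ising_poly b (B r) F t = q' / (1 + t * q')"
    unfolding ising_poly_split[OF graph(1), of _ _ _ v] ising_poly_split[OF fB, of _ _ _ v]
      q_def q'_def using a by (simp_all add: field_simps)
  then have "\<bar>occ_poly b V E v t / ising_poly b V E t
      - occ_poly b (B r) F v t / ising_poly b (B r) F t\<bar> = \<bar>q / (1 + t * q) - q' / (1 + t * q')\<bar>"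
    by (simp only:)
  also have "q / (1 + t * q) - q' / (1 + t * q') = (q - q') / ((1 + t * q) * (1 + t * q'))"
    using q t by (simp add: field_simps add_nonneg_eq_0_iff)
  also have "\<bar>(q - q') / ((1 + t * q) * (1 + t * q'))\<bar> \<le> \<bar>q - q'\<bar>"
  proof -
    have "1 * 1 \<le> (1 + t * q) * (1 + t * q')" using q t by (intro mult_mono) auto
    then show ?thesis by (simp add: abs_divide divide_le_eq mult_le_cancel_left1)
  qed
  also have "\<bar>q - q'\<bar> \<le> 2 * t ^ r"
    unfolding q_def q'_def by (rule occ_vac_ratio_ball[OF t])
  finally show ?thesis .
qed

end

text \<open>For \<open>b \<ge> 0\<close> and \<open>s > 0\<close>, \<open>s\<close> times the
  integrand is the probability that \<open>v \<in> S\<close> when \<open>S\<close> is drawn with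
  weight \<open>cut_weight b E S * s ^ card S\<close>. Dividing out \<open>s\<close> removes any
  singularity at 0.\<close>

definition site_energy :: "real \<Rightarrow> 'v set \<Rightarrow> ('v \<times> 'v) set \<Rightarrow> 'v \<Rightarrow> real \<Rightarrow> real" where
  "site_energy b V E v t = integral {0..t} (\<lambda>s. occ_poly b V E v s / ising_poly b V E s)"

lemma continuous_on_occ_ising_ratio:
  assumes "finite V" "0 \<le> b"
  shows "continuous_on {0..t :: real} (\<lambda>s. occ_poly b V E v s / ising_poly b V E s)"
proof -
  have "ising_poly b V E s \<noteq> 0" if "s \<in> {0..t}" for s
    using ising_poly_ge_1[OF assms, of s E] that by auto
  moreover have "continuous_on {0..t} (occ_poly b V E v)" "continuous_on {0..t} (ising_poly b V E)"
    unfolding occ_poly_def[abs_def] ising_poly_def[abs_def] by (intro continuous_intros)+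
  ultimately show ?thesis by (intro continuous_on_divide) auto
qed

text \<open>The factor \<open>card S\<close> from differentiation counts the vertices of
  \<open>S\<close>; exchanging the two sums groups the terms by vertex.\<close>

lemma DERIV_ising_poly:
  fixes b :: real
  assumes "finite V"
  shows "(ising_poly b V E has_real_derivative (\<Sum>v\<in>V. occ_poly b V E v t)) (at t within A)"
proof -
  have "(\<Sum>S\<in>Pow V. cut_weight b E S * (real (card S) * t ^ (card S - 1)))
    = (\<Sum>S\<in>Pow V. \<Sum>v | v \<in> V \<and> v \<in> S. cut_weight b E S * t ^ (card S - 1))"
  proof (intro sum.cong refl)
    fix S assume "S \<in> Pow V"
    then have "{v. v \<in> V \<and> v \<in> S} = S" by auto
    then show "cut_weight b E S * (real (card S) * t ^ (card S - 1))
      = (\<Sum>v | v \<in> V \<and> v \<in> S. cut_weight b E S * t ^ (card S - 1))" by simp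
  qed
  also have "\<dots> = (\<Sum>v\<in>V. occ_poly b V E v t)"
    unfolding occ_poly_def using assms by (subst sum.swap_restrict) auto
  finally show ?thesis
    unfolding ising_poly_def[abs_def]
    by (auto intro!: derivative_eq_intros sum.cong simp: mult_ac)
qed

text \<open>Integrate the logarithmic derivative from 0 to \<open>t\<close>. There is no boundary
  term, because at 0 only the empty set contributes and the polynomial equals 1.\<close>

lemma ln_ising_poly_eq_sum_site_energy:
  assumes "finite V" "0 \<le> b" "0 \<le> t"
  shows "ln (ising_poly b V E t) = (\<Sum>v\<in>V. site_energy b V E v t)"
proof -
  have pos: "ising_poly b V E s > 0" if "0 \<le> s" for s
    using ising_poly_ge_1[OF assms(1,2) that, of E] by linarith
  have "((\<lambda>s. \<Sum>v\<in>V. occ_poly b V E v s / ising_poly b V E s) has_integral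
      (ln (ising_poly b V E t) - ln (ising_poly b V E 0))) {0..t}"
  proof (rule fundamental_theorem_of_calculus[OF assms(3)])
    fix s assume "s \<in> {0..t}"
    then show "((\<lambda>s. ln (ising_poly b V E s)) has_vector_derivative
        (\<Sum>v\<in>V. occ_poly b V E v s / ising_poly b V E s)) (at s within {0..t})"
      unfolding has_real_derivative_iff_has_vector_derivative[symmetric]
      using pos[of s]
      by (auto intro!: derivative_eq_intros DERIV_ising_poly assms simp: sum_divide_distrib)
  qed
  moreover have "((\<lambda>s. \<Sum>v\<in>V. occ_poly b V E v s / ising_poly b V E s) has_integral
      (\<Sum>v\<in>V. site_energy b V E v t)) {0..t}"
    unfolding site_energy_def
    by (intro has_integral_sum assms integrable_integral integrable_continuous_interval
        continuous_on_occ_ising_ratio)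
  moreover have "ising_poly b V E 0 = 1"
  proof -
    have "(\<Sum>S\<in>Pow V. cut_weight b E S * 0 ^ card S) = (\<Sum>S\<in>{{}}. cut_weight b E S * 0 ^ card S)"
      using assms(1) by (intro sum.mono_neutral_right) (auto dest: finite_subset)
    then show ?thesis by (simp add: ising_poly_def cut_weight_empty)
  qed
  ultimately show ?thesis by (simp add: has_integral_unique)
qed

text \<open>The pointwise bound \<open>2 * s ^ r\<close> is at most \<open>2 * t ^ r\<close> on the
  whole interval, whose length \<open>t\<close> is below 1.\<close>

lemma site_energy_ball:
  fixes b t :: real and B :: "nat \<Rightarrow> 'v set"
  assumes b: "0 \<le> b" "b < 1"
    and graph: "finite V" "E \<subseteq> V \<times> V" "sym E"
    and ball: "B 0 = {v}" "mono B" "B r \<subseteq> V" "\<And>n. E `` B n \<subseteq> B (Suc n)"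
    and t: "0 \<le> t" "t < 1"
  shows "\<bar>site_energy b V E v t - site_energy b (B r) (E \<inter> B r \<times> B r) v t\<bar> \<le> 2 * t ^ r"
proof -
  define f where "f = (\<lambda>s. occ_poly b V E v s / ising_poly b V E s)"
  define g where "g = (\<lambda>s. occ_poly b (B r) (E \<inter> B r \<times> B r) v s / ising_poly b (B r) (E \<inter> B r \<times> B r) s)"
  have fB: "finite (B r)" using ball(3) graph(1) by (rule finite_subset)
  have cont: "continuous_on {0..t} f" "continuous_on {0..t} g"
    unfolding f_def g_def by (intro continuous_on_occ_ising_ratio graph(1) fB b(1))+
  have "\<bar>f s - g s\<bar> \<le> 2 * t ^ r" if "s \<in> {0..t}" for s
  proof -
    have "\<bar>f s - g s\<bar> \<le> 2 * s ^ r"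
      unfolding f_def g_def using that t
      by (intro occ_ising_ratio_ball[OF b graph ball]) auto
    also have "\<dots> \<le> 2 * t ^ r" using that by (simp add: power_mono)
    finally show ?thesis .
  qed
  then have "norm (integral {0..t} (\<lambda>s. f s - g s)) \<le> 2 * t ^ r * (t - 0)"
    using t cont by (intro integral_bound continuous_on_diff) auto
  also have "\<dots> \<le> 2 * t ^ r" using t by (simp add: mult_left_le)
  also have "integral {0..t} (\<lambda>s. f s - g s) = integral {0..t} f - integral {0..t} g"
    using cont by (intro integral_diff integrable_continuous_interval)
  finally show ?thesis unfolding site_energy_def f_def g_def by simp
qed

section \<open>Invariance of the site energy under injective relabelling\<close>

lemma cut_weight_image:
  assumes "inj_on f V" "E \<subseteq> V \<times> V" "S \<subseteq> V"
  shows "cut_weight b (map_prod f f ` E) (f ` S) = cut_weight b E S"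
proof -
  have "inj_on (map_prod f f) E"
    using map_prod_inj_on[OF assms(1,1)] assms(2) by (rule inj_on_subset)
  moreover have "(if f x \<in> f ` S \<longleftrightarrow> f y \<in> f ` S then 1 else b) = (if x \<in> S \<longleftrightarrow> y \<in> S then 1 else b)"
    if "(x, y) \<in> E" for x y
  proof -
    have "x \<in> V" "y \<in> V" using that assms(2) by auto
    then show ?thesis by (simp add: inj_on_image_mem_iff[OF assms(1) _ assms(3)])
  qed
  ultimately show ?thesis
    unfolding cut_weight_def by (subst prod.reindex) (auto intro!: prod.cong)
qed

lemma sum_subsets_image:
  assumes "inj_on f V"
  shows "(\<Sum>S | S \<subseteq> f ` V \<and> P S. g S) = (\<Sum>S | S \<subseteq> V \<and> P (f ` S). g (f ` S))"
  using assms
  by (intro sum.reindex_bij_witness[of _ "\<lambda>S. f ` S" "\<lambda>S. inv_into V f ` S"])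
    (auto simp: image_inv_into_cancel inv_into_image_cancel inv_into_into)

lemma ising_poly_image:
  assumes "inj_on f V" "E \<subseteq> V \<times> V"
  shows "ising_poly b (f ` V) (map_prod f f ` E) z = ising_poly b V E z"
proof -
  have "ising_poly b (f ` V) (map_prod f f ` E) z
      = (\<Sum>S | S \<subseteq> V \<and> True. cut_weight b (map_prod f f ` E) (f ` S) * z ^ card (f ` S))"
    unfolding ising_poly_def Pow_def by (subst sum_subsets_image[OF assms(1), symmetric]) simp
  also have "\<dots> = ising_poly b V E z"
    unfolding ising_poly_def Pow_def using assms
    by (intro sum.cong) (auto simp: cut_weight_image card_image inj_on_subset)
  finally show ?thesis .
qed

lemma occ_poly_image:
  assumes "inj_on f V" "E \<subseteq> V \<times> V" "v \<in> V"
  shows "occ_poly b (f ` V) (map_prod f f ` E) (f v) z = occ_poly b V E v z"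
proof -
  have "f v \<in> f ` S \<longleftrightarrow> v \<in> S" if "S \<subseteq> V" for S
    using inj_on_image_mem_iff[OF assms(1,3) that] .
  then have "{S. S \<subseteq> V \<and> f v \<in> f ` S} = {S. S \<subseteq> V \<and> v \<in> S}" by blast
  then show ?thesis
    unfolding occ_poly_def sum_subsets_image[OF assms(1)] using assms
    by (intro sum.cong) (auto simp: cut_weight_image card_image inj_on_subset)
qed

lemma site_energy_image:
  assumes "inj_on f V" "E \<subseteq> V \<times> V" "v \<in> V"
  shows "site_energy b (f ` V) (map_prod f f ` E) (f v) t = site_energy b V E v t"
  unfolding site_energy_def using assms by (simp add: occ_poly_image ising_poly_image)

section \<open>Balls and rooted isomorphism\<close>

context pair_wf_digraph
begin

lemma ball_verts_0: "v \<in> pverts G \<Longrightarrow> ball_verts G v 0 = {v}"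
  by (auto simp: ball_verts_def awalk_Nil_iff)

text \<open>Walks unfold at their first arc, whereas balls grow by the last one.\<close>

lemma awalk_snoc_iff: "awalk v (p @ [(x, y)]) u \<longleftrightarrow> awalk v p x \<and> (x, y) \<in> parcs G \<and> u = y"
  by (induction p arbitrary: v)
    (auto simp: awalk_Cons_iff awalk_Nil_iff in_arcsD1 in_arcsD2 simp del: awalk_append_iff)

lemma ball_verts_Suc: "ball_verts G v (Suc n) = ball_verts G v n \<union> parcs G `` ball_verts G v n"
proof (intro equalityI subsetI)
  fix u assume "u \<in> ball_verts G v (Suc n)"
  then obtain p where p: "awalk v p u" "length p \<le> Suc n" by (auto simp: ball_verts_def)
  show "u \<in> ball_verts G v n \<union> parcs G `` ball_verts G v n"
  proof (cases p rule: rev_cases)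
    case Nil
    then show ?thesis using p by (auto simp: ball_verts_def)
  next
    case (snoc q e)
    obtain x y where e: "e = (x, y)" by fastforce
    have "awalk v q x" "(x, u) \<in> parcs G" using p(1) by (auto simp: snoc e awalk_snoc_iff simp del: awalk_append_iff)
    moreover have "length q \<le> n" using p(2) snoc by simp
    ultimately show ?thesis by (auto simp: ball_verts_def)
  qed
next
  fix u assume u: "u \<in> ball_verts G v n \<union> parcs G `` ball_verts G v n"
  show "u \<in> ball_verts G v (Suc n)"
  proof (cases "u \<in> ball_verts G v n")
    case True
    then show ?thesis by (auto simp: ball_verts_def le_Suc_eq)
  next
    case False
    then obtain w p where w: "(w, u) \<in> parcs G" "awalk v p w" "length p \<le> n"
      using u by (auto simp: ball_verts_def)
    have "awalk v (p @ [(w, u)]) u" unfolding awalk_snoc_iff using w by simp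
    then show ?thesis using w(3) unfolding ball_verts_def
      by (intro CollectI exI[of _ "p @ [(w, u)]"]) auto
  qed
qed

lemma mono_ball_verts: "mono (ball_verts G v)"
  unfolding mono_iff_le_Suc by (auto simp: ball_verts_Suc)

lemma ball_verts_subset: "ball_verts G v n \<subseteq> pverts G"
  by (auto simp: ball_verts_def)

lemma root_in_ball_verts: "v \<in> pverts G \<Longrightarrow> v \<in> ball_verts G v n"
  using monoD[OF mono_ball_verts, of 0 n v] ball_verts_0 by auto

end

text \<open>Each vertex of a ball contributes at most \<open>D\<close> vertices to the next one. The
  bound is uniform in the graph, which leaves finitely many isomorphism classes of balls.\<close>

lemma (in pair_fin_digraph) card_ball_verts_le:
  assumes D: "\<And>v. v \<in> pverts G \<Longrightarrow> out_degree (with_proj G) v \<le> D" and v: "v \<in> pverts G"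
  shows "card (ball_verts G v n) \<le> (D + 1) ^ n"
proof (induction n)
  case 0
  then show ?case using v by (simp add: ball_verts_0)
next
  case (Suc n)
  let ?B = "ball_verts G v n"
  have fin: "finite ?B" using ball_verts_subset pair_finite_verts by (rule finite_subset)
  have "card (parcs G `` {u}) \<le> D" if "u \<in> ?B" for u
  proof -
    have "parcs G `` {u} = snd ` out_arcs (with_proj G) u" by (force simp: out_arcs_def)
    then have "card (parcs G `` {u}) \<le> out_degree (with_proj G) u"
      unfolding out_degree_def using pair_finite_arcs by (auto intro!: card_image_le simp: out_arcs_def)
    also have "\<dots> \<le> D" using that ball_verts_subset D by blast
    finally show ?thesis .
  qed
  then have "card (\<Union>u\<in>?B. parcs G `` {u}) \<le> card ?B * D"
    using card_UN_le[OF fin, of "\<lambda>u. parcs G `` {u}"]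
      sum_bounded_above[of ?B "\<lambda>u. card (parcs G `` {u})" D] by simp
  moreover have "card (ball_verts G v (Suc n)) \<le> card ?B + card (\<Union>u\<in>?B. parcs G `` {u})"
    unfolding ball_verts_Suc Image_eq_UN[of _ ?B] by (rule card_Un_le)
  ultimately have "card (ball_verts G v (Suc n)) \<le> card ?B * (D + 1)" by simp
  also have "\<dots> \<le> (D + 1) ^ n * (D + 1)" using Suc by (rule mult_right_mono) simp
  finally show ?case by (simp add: mult.commute)
qed

text \<open>The induced subgraph kept as a pair digraph, so that it is again a
  \<open>pair_graph\<close>; \<open>with_proj_ball_graph\<close> links it to the restriction used in
  \<open>ball_prob\<close>.\<close>

definition ball_graph :: "'a pair_pre_digraph \<Rightarrow> 'a \<Rightarrow> nat \<Rightarrow> 'a pair_pre_digraph" where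
  "ball_graph G v r = \<lparr>pverts = ball_verts G v r, parcs = parcs G \<inter> ball_verts G v r \<times> ball_verts G v r\<rparr>"

lemma ball_graph_simps [simp]:
  "pverts (ball_graph G v r) = ball_verts G v r"
  "parcs (ball_graph G v r) = parcs G \<inter> ball_verts G v r \<times> ball_verts G v r"
  by (simp_all add: ball_graph_def)

lemma with_proj_ball_graph: "with_proj G \<restriction> ball_verts G v r = with_proj (ball_graph G v r)"
  by (auto simp: induce_subgraph_def with_proj_def)

lemma pair_graph_iff:
  "pair_graph G \<longleftrightarrow> finite (pverts G) \<and> parcs G \<subseteq> pverts G \<times> pverts G \<and> sym (parcs G) \<and> irrefl (parcs G)"
proof
  assume "pair_graph G"
  then interpret pair_graph G .
  have "irrefl (parcs G)" using no_loops' by (intro irreflI) blast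
  then show "finite (pverts G) \<and> parcs G \<subseteq> pverts G \<times> pverts G \<and> sym (parcs G) \<and> irrefl (parcs G)"
    using pair_finite_verts pair_sym_arcs
    by (auto simp: symmetric_def dest: in_arcsD1 in_arcsD2)
next
  assume *: "finite (pverts G) \<and> parcs G \<subseteq> pverts G \<times> pverts G \<and> sym (parcs G) \<and> irrefl (parcs G)"
  then have "finite (parcs G)" by (meson finite_SigmaI finite_subset)
  with * show "pair_graph G"
    by unfold_locales (auto simp: symmetric_def irrefl_def)
qed

lemma pair_graph_ball_graph:
  assumes "pair_graph G"
  shows "pair_graph (ball_graph G v r)"
proof -
  interpret pair_graph G by fact
  have "finite (ball_verts G v r)" using ball_verts_subset pair_finite_verts by (rule finite_subset)
  then show ?thesis
    using assms unfolding pair_graph_iff by (auto simp: sym_def irrefl_def)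
qed

text \<open>Any two vertices are joined through the root, since reachability is symmetric. This
  serves to make balls admissible as test graphs.\<close>

lemma connected_if_root_reaches:
  assumes "parcs X \<subseteq> pverts X \<times> pverts X" "sym (parcs X)" "x \<in> pverts X"
    and reach: "\<And>u. u \<in> pverts X \<Longrightarrow> (x, u) \<in> (parcs X)\<^sup>*"
  shows "Digraph_Component.connected (with_proj X)"
proof -
  have "(u, w) \<in> rtrancl_on (pverts X) ((parcs X)\<^sup>s)" if "u \<in> pverts X" "w \<in> pverts X" for u w
  proof -
    have "(u, w) \<in> (parcs X)\<^sup>*"
      using reach[OF that(1)] reach[OF that(2)] sym_rtrancl[OF assms(2)]
      by (meson rtrancl_trans symD)
    then show ?thesis
    proof (induction rule: rtrancl_induct)
      case base
      then show ?case using that by simp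
    next
      case (step y z)
      then show ?case using assms(1)
        by (auto simp: symcl_def intro: rtrancl_on_into_rtrancl_on)
    qed
  qed
  then show ?thesis using assms(3) by (auto simp: connected_conv)
qed

text \<open>All prefixes of a walk of length at most \<open>r\<close> from \<open>v\<close> end
  inside the ball, so the walk never leaves the induced subgraph.\<close>

lemma (in pair_wf_digraph) ball_graph_root_reaches:
  assumes "v \<in> pverts G" "u \<in> ball_verts G v r"
  shows "(v, u) \<in> (parcs (ball_graph G v r))\<^sup>*"
proof -
  have "(v, u) \<in> (parcs (ball_graph G v r))\<^sup>*" if "u \<in> ball_verts G v n" "n \<le> r" for n u
    using that
  proof (induction n arbitrary: u)
    case 0
    then show ?case using assms(1) by (simp add: ball_verts_0)
  next
    case (Suc n)
    show ?case
    proof (cases "u \<in> ball_verts G v n")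
      case True
      then show ?thesis using Suc by simp
    next
      case False
      then obtain w where w: "w \<in> ball_verts G v n" "(w, u) \<in> parcs G"
        using Suc.prems(1) by (auto simp: ball_verts_Suc)
      have "w \<in> ball_verts G v r" "u \<in> ball_verts G v r"
        using w(1) Suc.prems monoD[OF mono_ball_verts, of n r v]
          monoD[OF mono_ball_verts, of "Suc n" r v] by auto
      then have "(w, u) \<in> parcs (ball_graph G v r)" using w(2) by simp
      then show ?thesis using Suc.IH[OF w(1)] Suc.prems(2) by (meson Suc_leD rtrancl_into_rtrancl)
    qed
  qed
  then show ?thesis using assms(2) by blast
qed

section \<open>Rooted isomorphisms as injective relabellings\<close>

definition relabel :: "('a \<Rightarrow> 'b) \<Rightarrow> 'a pair_pre_digraph \<Rightarrow> 'b pair_pre_digraph" where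
  "relabel f X = \<lparr>pverts = f ` pverts X, parcs = map_prod f f ` parcs X\<rparr>"

lemma relabel_simps [simp]:
  "pverts (relabel f X) = f ` pverts X" "parcs (relabel f X) = map_prod f f ` parcs X"
  by (simp_all add: relabel_def)

text \<open>An isomorphism record has its own arc map and end functions. Between pair digraphs tail
  and head are \<open>fst\<close> and \<open>snd\<close>, so the vertex map determines the arc
  map.\<close>

lemma rooted_iso_iff_relabel:
  assumes "pair_wf_digraph X"
  shows "rooted_iso (with_proj X) u (with_proj Y) w
    \<longleftrightarrow> (\<exists>f. inj_on f (pverts X) \<and> Y = relabel f X \<and> w = f u)"
proof
  assume "rooted_iso (with_proj X) u (with_proj Y) w"
  then obtain f where f: "pre_digraph.digraph_isomorphism (with_proj X) f"
    "with_proj Y = app_iso f (with_proj X)" "w = iso_verts f u" by (auto simp: rooted_iso_def)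
  have Y: "pverts Y = iso_verts f ` pverts X" "parcs Y = iso_arcs f ` parcs X"
    "iso_tail f = fst" "iso_head f = snd"
    using f(2) by (auto simp: with_proj_def app_iso_def)
  have "iso_arcs f a = map_prod (iso_verts f) (iso_verts f) a" if "a \<in> parcs X" for a
    using pre_digraph.iso_verts_tail[OF f(1), of a] pre_digraph.iso_verts_head[OF f(1), of a] that Y
    by (simp add: prod_eq_iff)
  then have "parcs Y = map_prod (iso_verts f) (iso_verts f) ` parcs X"
    unfolding Y(2) by (rule image_cong[OF refl])
  then have "Y = relabel (iso_verts f) X" using Y(1) by (simp add: relabel_def)
  moreover have "inj_on (iso_verts f) (pverts X)"
    using pre_digraph.digraph_isomorphism_inj_on_verts[OF f(1)] by simp
  ultimately show "\<exists>f. inj_on f (pverts X) \<and> Y = relabel f X \<and> w = f u" using f(3) by blast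
next
  assume "\<exists>f. inj_on f (pverts X) \<and> Y = relabel f X \<and> w = f u"
  then obtain f where f: "inj_on f (pverts X)" "Y = relabel f X" "w = f u" by blast
  let ?f = "\<lparr>iso_verts = f, iso_arcs = map_prod f f, iso_head = snd, iso_tail = fst\<rparr>"
  have "parcs X \<subseteq> pverts X \<times> pverts X"
    using assms by (auto dest: pair_wf_digraph.in_arcsD1 pair_wf_digraph.in_arcsD2)
  then have "inj_on (map_prod f f) (parcs X)"
    using map_prod_inj_on[OF f(1) f(1)] by (rule inj_on_subset[rotated])
  then have "pre_digraph.digraph_isomorphism (with_proj X) ?f"
    using assms f(1) by (simp add: pre_digraph.digraph_isomorphism_def wf_digraph_wp_iff)
  moreover have "with_proj Y = app_iso ?f (with_proj X)"
    by (simp add: f(2) with_proj_def app_iso_def)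
  ultimately show "rooted_iso (with_proj X) u (with_proj Y) w"
    unfolding rooted_iso_def using f(3) by (intro exI[of _ ?f]) simp
qed

lemma pair_graph_relabel:
  assumes "inj_on f (pverts X)" "pair_graph X"
  shows "pair_graph (relabel f X)"
proof -
  have X: "finite (pverts X)" "parcs X \<subseteq> pverts X \<times> pverts X" "sym (parcs X)" "irrefl (parcs X)"
    using assms(2) by (auto simp: pair_graph_iff)
  have "sym (map_prod f f ` parcs X)" using X(3) by (force simp: sym_def)
  moreover have "irrefl (map_prod f f ` parcs X)"
  proof (intro irreflI notI)
    fix a assume "(a, a) \<in> map_prod f f ` parcs X"
    then obtain x y where xy: "(x, y) \<in> parcs X" "f x = f y" by auto
    then have "x = y" using assms(1) X(2) by (auto dest: inj_onD)
    then show False using xy(1) X(4) by (simp add: irrefl_def)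
  qed
  moreover have "map_prod f f ` parcs X \<subseteq> f ` pverts X \<times> f ` pverts X" using X(2) by auto
  ultimately show ?thesis using X(1) by (simp add: pair_graph_iff)
qed

lemma rtrancl_relabel: "(u, w) \<in> R\<^sup>* \<Longrightarrow> (f u, f w) \<in> (map_prod f f ` R)\<^sup>*"
  by (induction rule: rtrancl_induct) (auto intro: rtrancl_into_rtrancl)

lemma connected_relabel_ball_graph:
  assumes "pair_graph G" "v \<in> pverts G" "inj_on f (ball_verts G v r)"
  shows "Digraph_Component.connected (with_proj (relabel f (ball_graph G v r)))"
proof (rule connected_if_root_reaches)
  let ?B = "ball_graph G v r"
  interpret pair_graph G by fact
  have "pair_graph (relabel f ?B)"
    using assms by (intro pair_graph_relabel pair_graph_ball_graph) auto
  then show "parcs (relabel f ?B) \<subseteq> pverts (relabel f ?B) \<times> pverts (relabel f ?B)"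
    "sym (parcs (relabel f ?B))" unfolding pair_graph_iff by auto
  show "f v \<in> pverts (relabel f ?B)" using root_in_ball_verts[OF assms(2)] by simp
  show "(f v, u) \<in> (parcs (relabel f ?B))\<^sup>*" if "u \<in> pverts (relabel f ?B)" for u
    using that rtrancl_relabel[OF ball_graph_root_reaches[OF assms(2)], of _ r f] by auto
qed

text \<open>The inverse relabelling returns \<open>w\<close> to \<open>u\<close> because
  \<open>u\<close> is a vertex of \<open>X\<close>, which \<open>rooted_iso\<close> alone does not
  guarantee.\<close>

lemma rooted_iso_sym:
  assumes "pair_wf_digraph X" "u \<in> pverts X" "rooted_iso (with_proj X) u (with_proj Y) w"
  shows "rooted_iso (with_proj Y) w (with_proj X) u"
proof -
  obtain f where f: "inj_on f (pverts X)" "Y = relabel f X" "w = f u"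
    using assms by (auto simp: rooted_iso_iff_relabel)
  have arcs: "parcs X \<subseteq> pverts X \<times> pverts X"
    using assms(1) by (auto dest: pair_wf_digraph.in_arcsD1 pair_wf_digraph.in_arcsD2)
  have "pair_wf_digraph Y" unfolding f(2) using arcs by (intro pair_wf_digraph.intro) auto
  moreover define g where "g = inv_into (pverts X) f"
  have g: "g (f x) = x" if "x \<in> pverts X" for x using f(1) that by (simp add: g_def)
  have "inj_on g (pverts Y)" unfolding g_def f(2) by (simp add: inj_on_inv_into)
  moreover have "X = relabel g Y"
  proof -
    have "g ` f ` pverts X = pverts X" using g by (force simp: image_comp)
    moreover have "map_prod g g (map_prod f f a) = a" if "a \<in> parcs X" for a
      using that arcs g by (cases a) auto
    then have "map_prod g g ` map_prod f f ` parcs X = parcs X" by (force simp: image_comp)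
    ultimately show ?thesis by (simp add: relabel_def f(2))
  qed
  moreover have "u = g w" using g[OF assms(2)] f(3) by simp
  ultimately show ?thesis by (auto simp: rooted_iso_iff_relabel)
qed

lemma rooted_iso_trans:
  assumes "pair_wf_digraph X" "pair_wf_digraph Y"
    and "rooted_iso (with_proj X) u (with_proj Y) v" "rooted_iso (with_proj Y) v (with_proj Z) w"
  shows "rooted_iso (with_proj X) u (with_proj Z) w"
proof -
  obtain f g where f: "inj_on f (pverts X)" "Y = relabel f X" "v = f u"
    and g: "inj_on g (pverts Y)" "Z = relabel g Y" "w = g v"
    using assms by (auto simp: rooted_iso_iff_relabel)
  have "inj_on (g \<circ> f) (pverts X)" using f g by (auto intro: comp_inj_on)
  moreover have "Z = relabel (g \<circ> f) X"
    by (simp add: f g relabel_def image_comp map_prod.comp)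
  ultimately show ?thesis using assms(1) f(3) g(3) by (auto simp: rooted_iso_iff_relabel intro!: exI[of _ "g \<circ> f"])
qed

lemma pair_graph_imp_pair_wf_digraph: "pair_graph X \<Longrightarrow> pair_wf_digraph X"
  by (simp add: pair_graph_def pair_digraph_def pair_fin_digraph_def)

lemma rooted_iso_relabel:
  assumes "pair_wf_digraph X" "inj_on f (pverts X)"
  shows "rooted_iso (with_proj X) u (with_proj (relabel f X)) (f u)"
  unfolding rooted_iso_iff_relabel[OF assms(1)] using assms(2) by blast

section \<open>Averages of local functions\<close>

text \<open>Bounding the vertex names by \<open>M\<close> makes the set finite, yet it still
  contains a copy of every ball with at most \<open>M\<close> vertices. One isomorphism class may
  occur many times.\<close>

definition ball_types :: "nat \<Rightarrow> (nat pair_pre_digraph \<times> nat) set" where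
  "ball_types M = {(X, x). pair_graph X \<and> Digraph_Component.connected (with_proj X) \<and> x \<in> pverts X
    \<and> pverts X \<subseteq> {..<M}}"

lemma finite_ball_types: "finite (ball_types M)"
proof (rule finite_subset)
  show "ball_types M \<subseteq> (\<lambda>((V, E), x). (\<lparr>pverts = V, parcs = E\<rparr>, x))
      ` ((Pow {..<M} \<times> Pow ({..<M} \<times> {..<M})) \<times> {..<M})"
  proof (clarify)
    fix X x assume "(X, x) \<in> ball_types M"
    then have "parcs X \<subseteq> pverts X \<times> pverts X" "x \<in> pverts X" "pverts X \<subseteq> {..<M}"
      by (auto simp: ball_types_def pair_graph_iff)
    then show "(X, x) \<in> (\<lambda>((V, E), x). (\<lparr>pverts = V, parcs = E\<rparr>, x))
        ` ((Pow {..<M} \<times> Pow ({..<M} \<times> {..<M})) \<times> {..<M})"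
      by (intro image_eqI[of _ _ "((pverts X, parcs X), x)"]) auto
  qed
qed simp

lemma ball_type_exists:
  assumes "pair_graph G" "v \<in> pverts G" "card (ball_verts G v r) \<le> M"
  shows "\<exists>(X, x) \<in> ball_types M. rooted_iso (with_proj (ball_graph G v r)) v (with_proj X) x"
proof -
  interpret pair_graph G by fact
  have "finite (ball_verts G v r)" using ball_verts_subset pair_finite_verts by (rule finite_subset)
  then obtain f where f: "bij_betw f (ball_verts G v r) {0..<card (ball_verts G v r)}"
    using ex_bij_betw_finite_nat by blast
  then have inj: "inj_on f (ball_verts G v r)" and im: "f ` ball_verts G v r = {0..<card (ball_verts G v r)}"
    by (auto simp: bij_betw_def)
  let ?X = "relabel f (ball_graph G v r)"
  have B: "pair_graph (ball_graph G v r)" using assms(1) by (rule pair_graph_ball_graph)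
  have "(?X, f v) \<in> ball_types M"
    using pair_graph_relabel[OF _ B, of f] connected_relabel_ball_graph[OF assms(1,2) inj]
      inj im assms(3) root_in_ball_verts[OF assms(2)] by (auto simp: ball_types_def)
  moreover have "rooted_iso (with_proj (ball_graph G v r)) v (with_proj ?X) (f v)"
    using rooted_iso_relabel[OF pair_graph_imp_pair_wf_digraph[OF B], of f v] inj by simp
  ultimately show ?thesis by blast
qed

text \<open>With bounded degree only finitely many ball types occur, so the average is a finite
  linear combination of ball probabilities with coefficients independent of \<open>n\<close>.
  \<open>F\<close> and \<open>F'\<close> stand for one invariant at two vertex types.\<close>

theorem BS_convergent_ball_average:
  fixes G :: "nat \<Rightarrow> 'a pair_pre_digraph" and F :: "'a pair_pre_digraph \<Rightarrow> 'a \<Rightarrow> real"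
  assumes graph: "\<And>n. pair_graph (G n)" and ne: "\<And>n. pverts (G n) \<noteq> {}"
    and BS: "BS_convergent G" and r: "0 < r"
    and inv: "\<And>X u Y y. pair_graph X \<Longrightarrow> u \<in> pverts X \<Longrightarrow>
      rooted_iso (with_proj X) u (with_proj Y) y \<Longrightarrow> F X u = F' (Y :: nat pair_pre_digraph) y"
  shows "convergent (\<lambda>n. (\<Sum>v\<in>pverts (G n). F (ball_graph (G n) v r) v) / card (pverts (G n)))"
proof -
  obtain D where D: "\<And>n v. v \<in> pverts (G n) \<Longrightarrow> out_degree (with_proj (G n)) v \<le> D"
    using BS unfolding BS_convergent_def by blast
  define A where "A = ball_types ((D + 1) ^ r)"
  define iso where "iso = (\<lambda>(X :: nat pair_pre_digraph, x) (Y :: nat pair_pre_digraph, y).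
    rooted_iso (with_proj X) x (with_proj Y) y)"
  define isov where "isov = (\<lambda>n v (Y :: nat pair_pre_digraph, y).
    rooted_iso (with_proj (ball_graph (G n) v r)) v (with_proj Y) y)"
  \<comment> \<open>The predicate under \<open>SOME\<close> is the same for all members of a class,
    so isomorphic types get the same representative. Without this choice a vertex would be counted
    once for every copy of its ball in \<open>A\<close>.\<close>
  define rep where "rep = (\<lambda>a. SOME b. b \<in> A \<and> iso a b)"
  define R where "R = rep ` A"
  have wfb: "pair_wf_digraph (ball_graph (G n) v r)" for n v
    by (intro pair_graph_imp_pair_wf_digraph pair_graph_ball_graph graph)
  have root: "v \<in> pverts (ball_graph (G n) v r)" if "v \<in> pverts (G n)" for n v
    using pair_wf_digraph.root_in_ball_verts[OF pair_graph_imp_pair_wf_digraph[OF graph] that] by simp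
  have A: "pair_wf_digraph (fst a)" "snd a \<in> pverts (fst a)" if "a \<in> A" for a
    using that by (auto simp: A_def ball_types_def pair_graph_imp_pair_wf_digraph)
  have iso_refl: "iso a a" if "a \<in> A" for a
  proof -
    have id: "relabel (\<lambda>x. x) X = X" for X :: "nat pair_pre_digraph" by (simp add: relabel_def map_prod.identity)
    show ?thesis using rooted_iso_relabel[OF A(1)[OF that], of "\<lambda>x. x" "snd a"]
      by (auto simp: iso_def id split: prod.splits)
  qed
  have iso_sym: "iso b a" if "a \<in> A" "iso a b" for a b
    using rooted_iso_sym[OF A[OF that(1)]] that(2) by (auto simp: iso_def split: prod.splits)
  have iso_trans: "iso a c" if "a \<in> A" "b \<in> A" "iso a b" "iso b c" for a b c
    using rooted_iso_trans[OF A(1)[OF that(1)] A(1)[OF that(2)]] that(3,4)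
    by (auto simp: iso_def split: prod.splits)
  have isov_trans: "isov n v b" if "isov n v a" "a \<in> A" "iso a b" for n v a b
    using rooted_iso_trans[OF wfb A(1)[OF that(2)]] that(1,3)
    by (auto simp: iso_def isov_def split: prod.splits)
  have isov_iso: "iso a b" if "v \<in> pverts (G n)" "isov n v a" "isov n v b" "a \<in> A" for n v a b
    using rooted_iso_trans[OF A(1)[OF that(4)] wfb rooted_iso_sym[OF wfb root[OF that(1)]]] that(2,3)
    by (auto simp: iso_def isov_def split: prod.splits)
  have rep: "rep a \<in> A" "iso a (rep a)" if "a \<in> A" for a
    using someI[of "\<lambda>b. b \<in> A \<and> iso a b" a] that iso_refl[OF that] by (auto simp: rep_def)
  have rep_eq: "rep a = rep b" if "a \<in> A" "b \<in> A" "iso a b" for a b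
  proof -
    have "(\<lambda>c. c \<in> A \<and> iso a c) = (\<lambda>c. c \<in> A \<and> iso b c)"
      using that iso_sym iso_trans by blast
    then show ?thesis by (simp add: rep_def)
  qed
  have finR: "finite R" by (simp add: R_def A_def finite_ball_types)
  have ex1: "\<exists>!b. b \<in> R \<and> isov n v b" if v: "v \<in> pverts (G n)" for n v
  proof -
    interpret pair_graph "G n" by (rule graph)
    have card: "card (ball_verts (G n) v r) \<le> (D + 1) ^ r"
      using D v by (intro card_ball_verts_le)
    then obtain a where a: "a \<in> A" "isov n v a"
      using ball_type_exists[OF graph v card] unfolding A_def isov_def by blast
    show ?thesis
    proof (rule ex1I[of _ "rep a"])
      show "rep a \<in> R \<and> isov n v (rep a)"
        using a rep isov_trans by (auto simp: R_def)
      show "b = rep a" if b: "b \<in> R \<and> isov n v b" for b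
      proof -
        obtain c where c: "c \<in> A" "b = rep c" using b unfolding R_def by blast
        have "iso (rep c) a" using isov_iso[OF v _ a(2)] b c rep by blast
        then have "iso c a" using iso_trans rep c(1) by blast
        then show ?thesis using rep_eq a(1) c by blast
      qed
    qed
  qed
  have "(\<Sum>v\<in>pverts (G n). F (ball_graph (G n) v r) v) / card (pverts (G n))
    = (\<Sum>(Y, y)\<in>R. ball_prob (G n) Y y r * F' Y y)" for n
  proof -
    interpret pair_graph "G n" by (rule graph)
    let ?V = "pverts (G n)"
    have "(\<Sum>v\<in>?V. F (ball_graph (G n) v r) v)
      = (\<Sum>v\<in>?V. \<Sum>b | b \<in> R \<and> isov n v b. case_prod F' b)"
    proof (rule sum.cong[OF refl])
      fix v assume v: "v \<in> ?V"
      then obtain b where b: "b \<in> R" "isov n v b" "\<And>c. c \<in> R \<Longrightarrow> isov n v c \<Longrightarrow> c = b"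
        using ex1[OF v] by blast
      then have "{b. b \<in> R \<and> isov n v b} = {b}" by blast
      moreover have "F (ball_graph (G n) v r) v = case_prod F' b"
        using inv[OF pair_graph_ball_graph[OF graph] root[OF v]] b(2)
        by (auto simp: isov_def split: prod.splits)
      ultimately show "F (ball_graph (G n) v r) v = (\<Sum>b | b \<in> R \<and> isov n v b. case_prod F' b)" by simp
    qed
    \<comment> \<open>Group the vertices by the representative of their ball; the size of a group is
      the ball probability times the number of vertices.\<close>
    also have "\<dots> = (\<Sum>b\<in>R. \<Sum>v | v \<in> ?V \<and> isov n v b. case_prod F' b)"
      using finR pair_finite_verts by (rule sum.swap_restrict[rotated])
    also have "\<dots> = (\<Sum>b\<in>R. card ?V * (ball_prob (G n) (fst b) (snd b) r * case_prod F' b))"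
    proof (rule sum.cong[OF refl])
      fix b assume "b \<in> R"
      have "ball_prob (G n) (fst b) (snd b) r = card {v. v \<in> ?V \<and> isov n v b} / card ?V"
        unfolding ball_prob_def with_proj_ball_graph isov_def
        by (subst measure_pmf_of_set[OF ne pair_finite_verts]) (simp add: Int_def case_prod_unfold)
      then show "(\<Sum>v | v \<in> ?V \<and> isov n v b. case_prod F' b)
        = card ?V * (ball_prob (G n) (fst b) (snd b) r * case_prod F' b)"
        using ne[of n] pair_finite_verts by simp
    qed
    also have "\<dots> = card ?V * (\<Sum>(Y, y)\<in>R. ball_prob (G n) Y y r * F' Y y)"
      by (simp add: sum_distrib_left case_prod_unfold)
    finally show ?thesis using ne[of n] pair_finite_verts by simp
  qed
  moreover have "convergent (\<lambda>n. \<Sum>b\<in>R. case b of (Y, y) \<Rightarrow> ball_prob (G n) Y y r * F' Y y)"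
  proof (rule convergent_sum)
    fix b assume "b \<in> R"
    then have "b \<in> A" using rep by (auto simp: R_def)
    then have "convergent (\<lambda>n. ball_prob (G n) (fst b) (snd b) r)"
      using BS r unfolding BS_convergent_def A_def ball_types_def by auto
    then show "convergent (\<lambda>n. case b of (Y, y) \<Rightarrow> ball_prob (G n) Y y r * F' Y y)"
      by (simp add: case_prod_unfold convergent_mult convergent_const)
  qed
  ultimately show ?thesis by simp
qed

text \<open>The sequence inherits the Cauchy property: two approximation errors of
  \<open>e / 4\<close> and an oscillation of \<open>Y\<close> below \<open>e / 2\<close>.\<close>

lemma convergent_if_uniformly_approximable:
  fixes X :: "nat \<Rightarrow> real"
  assumes "\<And>\<epsilon>. 0 < \<epsilon> \<Longrightarrow> \<exists>Y. convergent Y \<and> (\<forall>n. \<bar>X n - Y n\<bar> \<le> \<epsilon>)"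
  shows "convergent X"
proof (rule Cauchy_convergent, rule CauchyI)
  fix e :: real assume e: "0 < e"
  then obtain Y where Y: "convergent Y" "\<And>n. \<bar>X n - Y n\<bar> \<le> e / 4"
    using assms[of "e / 4"] by auto
  then obtain M where M: "\<And>m n. m \<ge> M \<Longrightarrow> n \<ge> M \<Longrightarrow> norm (Y m - Y n) < e / 2"
    using CauchyD[OF convergent_Cauchy[OF Y(1)], of "e / 2"] e by auto
  have "norm (X m - X n) < e" if "m \<ge> M" "n \<ge> M" for m n
    using M[OF that] Y(2)[of m] Y(2)[of n] unfolding real_norm_def by linarith
  then show "\<exists>M. \<forall>m\<ge>M. \<forall>n\<ge>M. norm (X m - X n) < e" by blast
qed

section \<open>Convergence of the Ising free energy per vertex\<close>

context
  fixes G :: "nat \<Rightarrow> 'a pair_pre_digraph" and b :: real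
  assumes graph: "\<And>n. pair_graph (G n)" and ne: "\<And>n. pverts (G n) \<noteq> {}"
    and BS: "BS_convergent G" and b: "0 \<le> b" "b < 1"
begin

lemma free_energy_convergent_field:
  assumes t: "0 < t" "t < 1"
  shows "convergent (\<lambda>n. ln (ising_poly b (pverts (G n)) (parcs (G n)) t) / card (pverts (G n)))"
proof (rule convergent_if_uniformly_approximable)
  fix \<epsilon> :: real assume "0 < \<epsilon>"
  then obtain k where k: "t ^ k < \<epsilon> / 2" using real_arch_pow_inv[of "\<epsilon> / 2" t] t by auto
  \<comment> \<open>The successor makes the radius positive, as the definition of Benjamini--Schramm
    convergence demands.\<close>
  define r where "r = Suc k"
  have "t ^ r \<le> 1 * t ^ k" unfolding r_def power_Suc using t by (intro mult_right_mono) auto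
  then have r: "0 < r" "2 * t ^ r \<le> \<epsilon>"
    using k unfolding r_def by simp_all
  define F where "F = (\<lambda>(X :: 'a pair_pre_digraph) u. site_energy b (pverts X) (parcs X) u t)"
  define F' where "F' = (\<lambda>(X :: nat pair_pre_digraph) u. site_energy b (pverts X) (parcs X) u t)"
  define Y where "Y = (\<lambda>n. (\<Sum>v\<in>pverts (G n). F (ball_graph (G n) v r) v) / card (pverts (G n)))"
  have "convergent Y"
    unfolding Y_def
  proof (rule BS_convergent_ball_average[OF graph ne BS r(1), of _ F'])
    fix X :: "'a pair_pre_digraph" and u and Y :: "nat pair_pre_digraph" and y
    assume X: "pair_graph X" "u \<in> pverts X" "rooted_iso (with_proj X) u (with_proj Y) y"
    then obtain f where "inj_on f (pverts X)" "Y = relabel f X" "y = f u"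
      by (auto simp: rooted_iso_iff_relabel pair_graph_imp_pair_wf_digraph)
    then show "F X u = F' Y y"
      using X by (simp add: F_def F'_def site_energy_image pair_graph_iff)
  qed
  moreover have "\<bar>ln (ising_poly b (pverts (G n)) (parcs (G n)) t) / card (pverts (G n)) - Y n\<bar> \<le> \<epsilon>" for n
  proof -
    interpret pair_graph "G n" by (rule graph)
    let ?V = "pverts (G n)" and ?E = "parcs (G n)"
    have c: "real (card ?V) > 0" using ne[of n] pair_finite_verts by (simp add: card_gt_0_iff)
    have GE: "finite ?V" "?E \<subseteq> ?V \<times> ?V" "sym ?E" using graph[of n] by (simp_all add: pair_graph_iff)
    have "\<bar>site_energy b ?V ?E v t - F (ball_graph (G n) v r) v\<bar> \<le> \<epsilon>" if "v \<in> ?V" for v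
    proof -
      have "\<bar>site_energy b ?V ?E v t - F (ball_graph (G n) v r) v\<bar> \<le> 2 * t ^ r"
        unfolding F_def ball_graph_simps
        by (rule site_energy_ball[OF b GE])
          (use t that ball_verts_0 mono_ball_verts ball_verts_subset ball_verts_Suc in auto)
      then show ?thesis using r(2) by linarith
    qed
    then have "\<bar>\<Sum>v\<in>?V. site_energy b ?V ?E v t - F (ball_graph (G n) v r) v\<bar> \<le> card ?V * \<epsilon>"
      by (intro order_trans[OF sum_abs] sum_bounded_above)
    moreover have "ln (ising_poly b ?V ?E t) / card ?V - Y n
      = (\<Sum>v\<in>?V. site_energy b ?V ?E v t - F (ball_graph (G n) v r) v) / card ?V"
      using t GE b by (simp add: Y_def ln_ising_poly_eq_sum_site_energy sum_subtractf diff_divide_distrib)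
    ultimately show ?thesis using c by (simp add: divide_le_eq mult.commute)
  qed
  ultimately show "\<exists>Y. convergent Y \<and>
      (\<forall>n. \<bar>ln (ising_poly b (pverts (G n)) (parcs (G n)) t) / card (pverts (G n)) - Y n\<bar> \<le> \<epsilon>)" by blast
qed

text \<open>At \<open>t = 1\<close> the error \<open>2 * t ^ r\<close> does not decay. Instead
  \<open>s ^ card V * P(1) \<le> P(s) \<le> P(1)\<close> with \<open>ln s = - \<epsilon>\<close>
  shows that the free energies per vertex at \<open>s\<close> and 1 differ by at most
  \<open>\<epsilon>\<close>, uniformly in the graph.\<close>

lemma free_energy_convergent:
  assumes t: "0 < t" "t \<le> 1"
  shows "convergent (\<lambda>n. ln (ising_poly b (pverts (G n)) (parcs (G n)) t) / card (pverts (G n)))"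
proof (cases "t < 1")
  case True
  then show ?thesis using t free_energy_convergent_field by simp
next
  case False
  then have t: "t = 1" using t by simp
  show ?thesis
  proof (rule convergent_if_uniformly_approximable)
    fix \<epsilon> :: real assume \<epsilon>: "0 < \<epsilon>"
    define s where "s = exp (- \<epsilon>)"
    have s: "0 < s" "s < 1" using \<epsilon> by (simp_all add: s_def)
    have "\<bar>ln (ising_poly b (pverts (G n)) (parcs (G n)) t) / card (pverts (G n))
      - ln (ising_poly b (pverts (G n)) (parcs (G n)) s) / card (pverts (G n))\<bar> \<le> \<epsilon>" for n
    proof -
      let ?V = "pverts (G n)" and ?E = "parcs (G n)"
      have fin: "finite ?V" using graph[of n] by (simp add: pair_graph_iff)
      have c: "real (card ?V) > 0" using ne[of n] fin by (simp add: card_gt_0_iff)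
      have pos: "ising_poly b ?V ?E 1 > 0" "ising_poly b ?V ?E s > 0"
        using ising_poly_ge_1[OF fin b(1), of 1 ?E] ising_poly_ge_1[OF fin b(1), of s ?E] s by auto
      have "ising_poly b ?V ?E s \<le> ising_poly b ?V ?E 1"
        unfolding ising_poly_def using s
        by (intro sum_mono mult_left_mono cut_weight_nonneg b) (simp_all add: power_le_one)
      moreover have "s ^ card ?V * ising_poly b ?V ?E 1 \<le> ising_poly b ?V ?E s"
        unfolding ising_poly_def sum_distrib_left
      proof (rule sum_mono)
        fix S assume "S \<in> Pow ?V"
        then have "s ^ card ?V \<le> s ^ card S"
          using s fin by (intro power_decreasing card_mono) auto
        then show "s ^ card ?V * (cut_weight b ?E S * 1 ^ card S) \<le> cut_weight b ?E S * s ^ card S"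
          using cut_weight_nonneg[OF b(1), of ?E S] using mult_left_mono by (fastforce simp: mult.commute)
      qed
      ultimately have "ln (ising_poly b ?V ?E s) \<le> ln (ising_poly b ?V ?E 1)"
        "ln (s ^ card ?V * ising_poly b ?V ?E 1) \<le> ln (ising_poly b ?V ?E s)"
        using pos s by simp_all
      moreover have "ln (s ^ card ?V * ising_poly b ?V ?E 1) = ln (ising_poly b ?V ?E 1) - card ?V * \<epsilon>"
        using pos s by (simp add: ln_mult ln_realpow) (simp add: s_def)
      ultimately have "\<bar>ln (ising_poly b ?V ?E 1) - ln (ising_poly b ?V ?E s)\<bar> \<le> card ?V * \<epsilon>" using \<epsilon> by linarith
      then show ?thesis
        using c by (simp add: t divide_le_eq mult.commute flip: diff_divide_distrib)
    qed
    then show "\<exists>Y. convergent Y \<and>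
      (\<forall>n. \<bar>ln (ising_poly b (pverts (G n)) (parcs (G n)) t) / card (pverts (G n)) - Y n\<bar> \<le> \<epsilon>)"
      using free_energy_convergent_field[OF s] by blast
  qed
qed

end

section \<open>Reduction to the Ising polynomial\<close>

lemma transpose_eq_imp_component:
  assumes "transpose N = N"
  shows "N $ i $ j = N $ j $ i"
proof -
  have "transpose N $ i $ j = N $ j $ i" by (simp add: transpose_def)
  then show ?thesis by (simp add: assms)
qed

text \<open>Each edge is the image of exactly two arcs, distinct because there are no loops and
  equal in weight by symmetry; each supplies one square root.\<close>

lemma (in pair_graph) prod_edges_eq_prod_arcs:
  fixes N :: "real ^ 'c ^ 'c"
  assumes sym: "transpose N = N" and nonneg: "\<And>i j. 0 \<le> N $ i $ j"
  shows "(\<Prod>e\<in>edges G. edge_weight N \<sigma> e) = (\<Prod>(x, y)\<in>parcs G. sqrt (N $ \<sigma> x $ \<sigma> y))"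
proof -
  have "(\<Prod>(x, y)\<in>parcs G. sqrt (N $ \<sigma> x $ \<sigma> y))
    = (\<Prod>e\<in>edges G. \<Prod>a | a \<in> parcs G \<and> (\<lambda>(u, v). {u, v}) a = e. case a of (x, y) \<Rightarrow> sqrt (N $ \<sigma> x $ \<sigma> y))"
    using pair_finite_arcs by (intro prod.group[symmetric]) (auto simp: edges_def)
  also have "\<dots> = (\<Prod>e\<in>edges G. edge_weight N \<sigma> e)"
  proof (rule prod.cong[OF refl])
    fix e assume "e \<in> edges G"
    then obtain u v where uv: "(u, v) \<in> parcs G" "e = {u, v}" by (auto simp: edges_def)
    have "{a. a \<in> parcs G \<and> (\<lambda>(u, v). {u, v}) a = e} = {(u, v), (v, u)}"
      using uv arcs_symmetric by (auto simp: doubleton_eq_iff)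
    moreover have "u \<noteq> v" using uv(1) no_loops' by blast
    ultimately show "(\<Prod>a | a \<in> parcs G \<and> (\<lambda>(u, v). {u, v}) a = e. case a of (x, y) \<Rightarrow> sqrt (N $ \<sigma> x $ \<sigma> y))
      = edge_weight N \<sigma> e"
      using nonneg[of "\<sigma> u" "\<sigma> v"] transpose_eq_imp_component[OF sym, of "\<sigma> v" "\<sigma> u"]
      by (simp add: edge_weight_doubleton[OF sym] uv(2))
  qed
  finally show ?thesis by simp
qed

text \<open>Every vertex is the tail of \<open>d\<close> arcs and, by reversing arcs, the head of
  \<open>d\<close> arcs.\<close>

lemma prod_arcs_endpoints:
  fixes f :: "'a \<Rightarrow> real"
  assumes "regular_graph d G"
  shows "(\<Prod>(x, y)\<in>parcs G. f x * f y) = (\<Prod>v\<in>pverts G. f v ^ (2 * d))"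
proof -
  interpret pair_graph G using assms by (simp add: regular_graph_def)
  have deg: "card {a. a \<in> parcs G \<and> fst a = v} = d" if "v \<in> pverts G" for v
    using assms that by (simp add: regular_graph_def out_degree_def out_arcs_def)
  have "(\<Prod>a\<in>parcs G. f (fst a)) = (\<Prod>v\<in>pverts G. \<Prod>a | a \<in> parcs G \<and> fst a = v. f (fst a))"
    using pair_finite_arcs pair_finite_verts by (intro prod.group[symmetric]) (auto dest: in_arcsD1)
  also have "\<dots> = (\<Prod>v\<in>pverts G. f v ^ d)"
    by (intro prod.cong refl) (simp add: deg)
  finally have 1: "(\<Prod>a\<in>parcs G. f (fst a)) = (\<Prod>v\<in>pverts G. f v ^ d)" .
  have 2: "(\<Prod>a\<in>parcs G. f (snd a)) = (\<Prod>a\<in>parcs G. f (fst a))"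
    by (rule prod.reindex_bij_witness[of _ prod.swap prod.swap]) (auto intro: arcs_symmetric)
  show ?thesis
    by (simp add: case_prod_unfold prod.distrib 1 2 mult_2 power_add)
qed

text \<open>With two spins an assignment on \<open>V\<close> amounts to the set of vertices of spin
  \<open>i\<close>.\<close>

lemma sum_two_spin:
  fixes g :: "'v set \<Rightarrow> real" and m :: "2 \<Rightarrow> real"
  assumes "finite V" "i \<noteq> j"
  shows "(\<Sum>\<sigma> \<in> V \<rightarrow>\<^sub>E (UNIV :: 2 set). (\<Prod>v\<in>V. m (\<sigma> v)) * g {v \<in> V. \<sigma> v = i})
    = (\<Sum>S\<in>Pow V. m i ^ card S * m j ^ (card V - card S) * g S)"
proof -
  have two: "k = i \<or> k = j" for k :: 2 using assms(2) exhaust_2 by metis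
  have pm: "(\<Prod>v\<in>V. m (\<sigma> v)) = m i ^ card {v \<in> V. \<sigma> v = i} * m j ^ (card V - card {v \<in> V. \<sigma> v = i})" for \<sigma>
  proof -
    let ?S = "{v \<in> V. \<sigma> v = i}"
    have "(\<Prod>v\<in>V. m (\<sigma> v)) = (\<Prod>v\<in>?S. m (\<sigma> v)) * (\<Prod>v\<in>V - ?S. m (\<sigma> v))"
      using assms(1) by (subst prod.subset_diff[of ?S V]) (auto simp: mult.commute)
    also have "(\<Prod>v\<in>?S. m (\<sigma> v)) = m i ^ card ?S" by simp
    also have "(\<Prod>v\<in>V - ?S. m (\<sigma> v)) = (\<Prod>v\<in>V - ?S. m j)"
      using two by (intro prod.cong) auto
    finally show ?thesis using assms(1) by (simp add: card_Diff_subset)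
  qed
  show ?thesis
    unfolding pm
    by (rule sum.reindex_bij_witness[of _ "\<lambda>S. \<lambda>v\<in>V. if v \<in> S then i else j" "\<lambda>\<sigma>. {v \<in> V. \<sigma> v = i}"])
      (use two assms(2) in \<open>auto simp: PiE_iff extensional_def fun_eq_iff restrict_def\<close>)
qed

text \<open>With \<open>s k\<close> the fourth root of \<open>N $ k $ k\<close>,
  \<open>sqrt (N $ k $ l)\<close> is \<open>s k * s l\<close>, times \<open>b\<close> when the spins
  differ. By regularity the factors \<open>s\<close> collect to \<open>s k ^ (2 * d)\<close> at each
  vertex and join \<open>\<mu>\<close> in \<open>m\<close>. Taking \<open>m j\<close> out at every
  vertex leaves the activity \<open>m i / m j\<close>.\<close>

lemma partition_function_eq_ising_poly:
  fixes N :: "real ^ 2 ^ 2" and \<mu> :: "real ^ 2"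
  assumes G: "regular_graph d G" and sym: "transpose N = N"
    and N: "\<And>i j. 0 < N $ i $ j" and \<mu>: "\<And>i. 0 < \<mu> $ i" and ij: "i \<noteq> j"
  defines "b \<equiv> sqrt (N $ i $ j / sqrt (N $ i $ i * N $ j $ j))"
    and "m \<equiv> (\<lambda>k. \<mu> $ k * sqrt (sqrt (N $ k $ k)) ^ (2 * d))"
  shows "partition_function G N \<mu> = m j ^ card (pverts G) * ising_poly b (pverts G) (parcs G) (m i / m j)"
proof -
  interpret pair_graph G using G by (simp add: regular_graph_def)
  let ?V = "pverts G" and ?E = "parcs G"
  define s where "s = (\<lambda>k :: 2. sqrt (sqrt (N $ k $ k)))"
  have two: "k = i \<or> k = j" for k :: 2 using ij exhaust_2 by metis
  have symN: "N $ j $ i = N $ i $ j" using sym by (rule transpose_eq_imp_component)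
  have fac: "sqrt (N $ k $ l) = s k * s l * (if k = i \<longleftrightarrow> l = i then 1 else b)" for k l
  proof -
    have diag: "s k * s k = sqrt (N $ k $ k)" for k using N[of k k] by (simp add: s_def)
    have off: "s i * s j * b = sqrt (N $ i $ j)"
      using N[of i i] N[of j j] by (simp add: s_def b_def real_sqrt_mult real_sqrt_divide)
    show ?thesis
      using two[of k] two[of l] ij diag off symN by (auto simp: mult.commute)
  qed
  have "(\<Prod>v\<in>?V. \<mu> $ \<sigma> v) * (\<Prod>e\<in>edges G. edge_weight N \<sigma> e)
    = (\<Prod>v\<in>?V. m (\<sigma> v)) * cut_weight b ?E {v \<in> ?V. \<sigma> v = i}" for \<sigma>
  proof -
    have "(\<Prod>e\<in>edges G. edge_weight N \<sigma> e)
      = (\<Prod>(x, y)\<in>?E. s (\<sigma> x) * s (\<sigma> y) * (if \<sigma> x = i \<longleftrightarrow> \<sigma> y = i then 1 else b))"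
      using N by (subst prod_edges_eq_prod_arcs[OF sym]) (simp_all add: fac less_imp_le)
    also have "\<dots> = (\<Prod>(x, y)\<in>?E. s (\<sigma> x) * s (\<sigma> y)) * cut_weight b ?E {v \<in> ?V. \<sigma> v = i}"
      unfolding cut_weight_def case_prod_unfold prod.distrib[symmetric]
      using arc_fst_in_verts arc_snd_in_verts by (intro prod.cong) auto
    also have "(\<Prod>(x, y)\<in>?E. s (\<sigma> x) * s (\<sigma> y)) = (\<Prod>v\<in>?V. s (\<sigma> v) ^ (2 * d))"
      by (rule prod_arcs_endpoints[OF G])
    finally show ?thesis by (simp add: m_def s_def prod.distrib)
  qed
  then have "partition_function G N \<mu> = (\<Sum>S\<in>Pow ?V. m i ^ card S * m j ^ (card ?V - card S) * cut_weight b ?E S)"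
    unfolding partition_function_def using sum_two_spin[OF pair_finite_verts ij, of m "cut_weight b ?E"] by simp
  also have "\<dots> = m j ^ card ?V * ising_poly b ?V ?E (m i / m j)"
    unfolding ising_poly_def sum_distrib_left
  proof (rule sum.cong[OF refl])
    fix S assume "S \<in> Pow ?V"
    then have "card ?V = card S + (card ?V - card S)" using pair_finite_verts by (simp add: card_mono)
    then have "m j ^ card ?V = m j ^ card S * m j ^ (card ?V - card S)" by (metis power_add)
    moreover have "m j \<noteq> 0" using \<mu>[of j] N[of j j] by (simp add: m_def)
    ultimately show "m i ^ card S * m j ^ (card ?V - card S) * cut_weight b ?E S
      = m j ^ card ?V * (cut_weight b ?E S * (m i / m j) ^ card S)"
      by (simp add: power_divide)
  qed
  finally show ?thesis .
qed

text \<open>This is positivity of the determinant, in the form that yields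
  \<open>b < 1\<close>.\<close>

lemma positive_definite_offdiag_lt:
  fixes N :: "real ^ 2 ^ 2"
  assumes "positive_definite N" "\<And>i j. 0 < N $ i $ j" "i \<noteq> j"
  shows "N $ i $ j < sqrt (N $ i $ i * N $ j $ j)"
proof -
  have symN: "N $ j $ i = N $ i $ j"
    using assms(1) by (auto simp: positive_definite_def intro: transpose_eq_imp_component)
  have "k = i \<or> k = j" for k :: 2 using assms(3) exhaust_2 by metis
  then have two: "(UNIV :: 2 set) = {i, j}" by auto
  \<comment> \<open>This vector makes the \<open>i\<close> component of \<open>N *v x\<close>
    vanish, so the quadratic form reduces to \<open>N $ i $ i\<close> times the determinant.\<close>
  define x :: "real ^ 2" where "x = (\<chi> k. if k = i then - N $ i $ j else N $ i $ i)"
  have "x \<noteq> 0" using assms(2)[of i i] assms(3) by (auto simp: x_def vec_eq_iff)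
  then have "0 < x \<bullet> (N *v x)" using assms(1) by (simp add: positive_definite_def)
  also have "x \<bullet> (N *v x) = N $ i $ i * (N $ i $ i * N $ j $ j - (N $ i $ j)\<^sup>2)"
    using assms(3) by (simp add: inner_vec_def matrix_vector_mult_def two x_def symN algebra_simps power2_eq_square)
  finally have "(N $ i $ j)\<^sup>2 < N $ i $ i * N $ j $ j"
    using assms(2)[of i i] by (simp add: zero_less_mult_iff)
  then show ?thesis by (rule real_less_rsqrt)
qed

theorem theorem3p29:
  fixes d :: nat
    and N :: "real ^ 2 ^ 2"
    and \<mu> :: "real ^ 2"
    and G :: "nat \<Rightarrow> 'a pair_pre_digraph"
  assumes "0 < d"
    and "positive_definite N"
    and "\<And>i j. 0 < N $ i $ j"
    and "\<And>i. 0 < \<mu> $ i"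
    and "\<And>n. regular_graph d (G n)"
    and "\<And>n. pverts (G n) \<noteq> {}"
    and "BS_convergent G"
  shows "convergent (\<lambda>n. 1 / real (card (pverts (G n))) * ln (partition_function (G n) N \<mu>))"
proof -
  define m where "m = (\<lambda>k. \<mu> $ k * sqrt (sqrt (N $ k $ k)) ^ (2 * d))"
  have m: "m k > 0" for k using assms(3)[of k k] assms(4)[of k] by (simp add: m_def)
  \<comment> \<open>Naming the spins so that \<open>m i \<le> m j\<close> puts the activity
    \<open>m i / m j\<close> into the interval from 0 to 1.\<close>
  obtain i j :: 2 where ij: "i \<noteq> j" "m i \<le> m j"
    by (metis linear zero_neq_one)
  define b where "b = sqrt (N $ i $ j / sqrt (N $ i $ i * N $ j $ j))"
  have sym: "transpose N = N" using assms(2) by (simp add: positive_definite_def)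
  have b: "0 \<le> b" "b < 1"
    using positive_definite_offdiag_lt[OF assms(2,3) ij(1)] assms(3)[of i j] assms(3)[of i i] assms(3)[of j j]
    by (simp_all add: b_def divide_less_eq)
  have graph: "pair_graph (G n)" for n using assms(5)[of n] by (simp add: regular_graph_def)
  define f where "f = (\<lambda>n. ln (ising_poly b (pverts (G n)) (parcs (G n)) (m i / m j)) / card (pverts (G n)))"
  \<comment> \<open>The prefactor \<open>m j ^ card (pverts (G n))\<close> contributes the same
    constant \<open>ln (m j)\<close> for every \<open>n\<close>.\<close>
  have "1 / real (card (pverts (G n))) * ln (partition_function (G n) N \<mu>) = ln (m j) + f n" for n
  proof -
    let ?P = "ising_poly b (pverts (G n)) (parcs (G n)) (m i / m j)"
    have fin: "finite (pverts (G n))" using graph[of n] by (simp add: pair_graph_iff)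
    have c: "real (card (pverts (G n))) > 0" using assms(6)[of n] fin by (simp add: card_gt_0_iff)
    have "?P > 0" using ising_poly_ge_1[OF fin b(1), of "m i / m j" "parcs (G n)"] m[of i] m[of j] by simp
    moreover have "partition_function (G n) N \<mu> = m j ^ card (pverts (G n)) * ?P"
      unfolding b_def m_def by (rule partition_function_eq_ising_poly[OF assms(5) sym assms(3,4) ij(1)])
    ultimately have "ln (partition_function (G n) N \<mu>) = card (pverts (G n)) * ln (m j) + ln ?P"
      using m[of j] by (simp add: ln_mult ln_realpow)
    then show ?thesis using c by (simp add: f_def field_simps)
  qed
  moreover have "convergent f"
    unfolding f_def using m ij(2)
    by (intro free_energy_convergent[OF graph assms(6,7) b]) simp_all
  ultimately show ?thesis by (simp add: convergent_add convergent_const)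
qed

end
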